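(* Let $q$ be the square of a prime power. There are exactly $(q+1)\sqrt{q}$ extremal Peisert-type graphs defined over $\mathbb{F}_{q^2}$, and every Peisert-type graph of type $(3,q)$ is a subgraph (i.e. its connection set is contained in the connection set) of exactly one of them. Moreover, if $X$ is any extremal Peisert-type graph defined over $\mathbb{F}_{q^2}$, then: (1) $X$ is unique up to isomorphism; in fact $X$ is isomorphic to the affine polar graph $VO^+(4,\sqrt{q})$; (2) $X$ has exactly $\sqrt{q}+1$ canonical cliques containing $0$ and exactly $\sqrt{q}+1$ non-canonical (maximum) cliques containing $0$, and these $2(\sqrt{q}+1)$ cliques lie in a single orbit of the automorphism group of $X$; (3) every maximal clique of $X$ is a maximum clique; (4) the weight-distribution bound is tight for both non-principal eigenvalues of $X$.
   Context: For an abelian group $G$ and $S\subseteq G\setminus\{0\}$ with $S=-S$, $\operatorname{Cay}(G,S)$ is the graph on $G$ with $g\sim h$ iff $g-h\in S$. A Peisert-type graph of type $(m,q)$ (defined over $\mathbb{F}_{q^2}$) is $\operatorname{Cay}(\mathbb{F}_{q^2}^+,S)$ with $S=c_1\mathbb{F}_q^*\cup\cdots\cup c_m\mathbb{F}_q^*$ a union of $m\le q$ distinct cosets of $\mathbb{F}_q^*$ in $\mathbb{F}_{q^2}^*$. Its clique number is $q$; maximum cliques have size $q$. Canonical cliques are the sets $x+c_i\mathbb{F}_q$ ($x\in\mathbb{F}_{q^2}$); a non-canonical clique is a maximum clique that is not canonical. The strict-EKR property means all maximum cliques are canonical. A Peisert-type graph of type $(m,q)$ is extremal if it lacks the strict-EKR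 property while all Peisert-type graphs of type $(m-1,q)$ have it. For a prime power $r$, the affine polar graph $VO^+(4,r)$ has vertex set $\mathbb{F}_r^4$, with distinct $x,y$ adjacent iff $Q(x-y)=0$ where $Q(z)=z_1z_2+z_3z_4$. A real function $f\not\equiv 0$ on the vertices of a graph is a $\theta$-eigenfunction if $\theta f(\gamma)=\sum_{\delta\sim\gamma}f(\delta)$ for all vertices $\gamma$. For a primitive strongly regular graph with non-principal eigenvalues $\theta_2<0<\theta_1$, every $\theta_1$-eigenfunction has at least $2(\theta_1+1)$ nonzero values and every $\theta_2$-eigenfunction at least $-2\theta_2$ nonzero values (the weight-distribution bound); it is tight for an eigenvalue if some eigenfunction for that eigenvalue attains it. *)

theory Defs
  imports Complex_Main "HOL-Number_Theory.Prime_Powers"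
begin

section \<open>Graphs\<close>

record 'a graph =
  verts :: "'a set"
  adj :: "'a \<Rightarrow> 'a \<Rightarrow> bool"

definition graph_isomorphism :: "('a \<Rightarrow> 'b) \<Rightarrow> 'a graph \<Rightarrow> 'b graph \<Rightarrow> bool" where
  "graph_isomorphism f G H \<longleftrightarrow>
     bij_betw f (verts G) (verts H) \<and>
     (\<forall>x\<in>verts G. \<forall>y\<in>verts G. adj G x y \<longleftrightarrow> adj H (f x) (f y))"

definition isomorphic :: "'a graph \<Rightarrow> 'b graph \<Rightarrow> bool" where
  "isomorphic G H \<longleftrightarrow> (\<exists>f. graph_isomorphism f G H)"

abbreviation automorphism :: "'a graph \<Rightarrow> ('a \<Rightarrow> 'a) \<Rightarrow> bool" where
  "automorphism G f \<equiv> graph_isomorphism f G G"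

text \<open>The orbit of a vertex set under the automorphism group.\<close>

definition set_orbit :: "'a graph \<Rightarrow> 'a set \<Rightarrow> 'a set set" where
  "set_orbit G C = {f ` C | f. automorphism G f}"

definition clique :: "'a graph \<Rightarrow> 'a set \<Rightarrow> bool" where
  "clique G C \<longleftrightarrow> C \<subseteq> verts G \<and> (\<forall>x\<in>C. \<forall>y\<in>C. x \<noteq> y \<longrightarrow> adj G x y)"

definition maximal_clique :: "'a graph \<Rightarrow> 'a set \<Rightarrow> bool" where
  "maximal_clique G C \<longleftrightarrow> clique G C \<and> (\<forall>D. clique G D \<and> C \<subseteq> D \<longrightarrow> D = C)"

definition maximum_clique :: "'a graph \<Rightarrow> 'a set \<Rightarrow> bool" where
  "maximum_clique G C \<longleftrightarrow>
     clique G C \<and> finite C \<and> (\<forall>D. clique G D \<longrightarrow> finite D \<and> card D \<le> card C)"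

section \<open>Strongly regular graphs and eigenfunctions\<close>

definition simple_graph :: "'a graph \<Rightarrow> bool" where
  "simple_graph G \<longleftrightarrow> finite (verts G) \<and> verts G \<noteq> {} \<and>
     (\<forall>x\<in>verts G. \<not> adj G x x) \<and>
     (\<forall>x\<in>verts G. \<forall>y\<in>verts G. adj G x y \<longrightarrow> adj G y x)"

definition nbhd :: "'a graph \<Rightarrow> 'a \<Rightarrow> 'a set" where
  "nbhd G x = {y \<in> verts G. adj G x y}"

definition graph_complement :: "'a graph \<Rightarrow> 'a graph" where
  "graph_complement G = \<lparr>verts = verts G, adj = (\<lambda>x y. x \<noteq> y \<and> \<not> adj G x y)\<rparr>"

definition connected_graph :: "'a graph \<Rightarrow> bool" where
  "connected_graph G \<longleftrightarrow>
     (\<forall>x\<in>verts G. \<forall>y\<in>verts G. (x, y) \<in> {(u, v). u \<in> verts G \<and> v \<in> nbhd G u}\<^sup>*)"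

definition strongly_regular :: "'a graph \<Rightarrow> nat \<Rightarrow> nat \<Rightarrow> nat \<Rightarrow> bool" where
  "strongly_regular G k l m \<longleftrightarrow> simple_graph G \<and>
     (\<exists>x\<in>verts G. \<exists>y\<in>verts G. adj G x y) \<and>
     (\<exists>x\<in>verts G. \<exists>y\<in>verts G. x \<noteq> y \<and> \<not> adj G x y) \<and>
     (\<forall>x\<in>verts G. card (nbhd G x) = k) \<and>
     (\<forall>x\<in>verts G. \<forall>y\<in>verts G. adj G x y \<longrightarrow> card (nbhd G x \<inter> nbhd G y) = l) \<and>
     (\<forall>x\<in>verts G. \<forall>y\<in>verts G. x \<noteq> y \<and> \<not> adj G x y \<longrightarrow> card (nbhd G x \<inter> nbhd G y) = m)"

definition primitive_strongly_regular :: "'a graph \<Rightarrow> nat \<Rightarrow> nat \<Rightarrow> nat \<Rightarrow> bool" where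
  "primitive_strongly_regular G k l m \<longleftrightarrow>
     strongly_regular G k l m \<and> connected_graph G \<and> connected_graph (graph_complement G)"

definition eigenfunction :: "'a graph \<Rightarrow> real \<Rightarrow> ('a \<Rightarrow> real) \<Rightarrow> bool" where
  "eigenfunction G \<theta> f \<longleftrightarrow> (\<exists>x\<in>verts G. f x \<noteq> 0) \<and>
     (\<forall>x\<in>verts G. \<theta> * f x = (\<Sum>y\<in>nbhd G x. f y))"

text \<open>The principal eigenvalue of a connected \<open>k\<close>-regular graph is its valency \<open>k\<close>.\<close>

definition nonprincipal_eigenvalues :: "'a graph \<Rightarrow> nat \<Rightarrow> real set" where
  "nonprincipal_eigenvalues G k = {\<theta>. (\<exists>f. eigenfunction G \<theta> f) \<and> \<theta> \<noteq> real k}"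

text \<open>
  The weight-distribution bound for a non-principal eigenvalue \<open>\<theta>\<close> of a primitive strongly
  regular graph, for which \<open>\<theta> \<noteq> 0\<close>.
\<close>

definition weight_distribution_bound :: "real \<Rightarrow> real" where
  "weight_distribution_bound \<theta> = (if \<theta> > 0 then 2 * (\<theta> + 1) else - 2 * \<theta>)"

definition weight_distribution_bound_tight :: "'a graph \<Rightarrow> real \<Rightarrow> bool" where
  "weight_distribution_bound_tight G \<theta> \<longleftrightarrow>
     (\<exists>f. eigenfunction G \<theta> f \<and>
          real (card {x \<in> verts G. f x \<noteq> 0}) = weight_distribution_bound \<theta>)"

section \<open>Peisert-type graphs\<close>

definition is_subfield :: "'a::field set \<Rightarrow> bool" where
  "is_subfield K \<longleftrightarrow> 1 \<in> K \<and>
     (\<forall>x\<in>K. \<forall>y\<in>K. x - y \<in> K \<and> x * y \<in> K) \<and> (\<forall>x\<in>K. x \<noteq> 0 \<longrightarrow> inverse x \<in> K)"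

definition Cay :: "'a::ab_group_add set \<Rightarrow> 'a graph" where
  "Cay S = \<lparr>verts = UNIV, adj = (\<lambda>g h. g - h \<in> S)\<rparr>"

text \<open>
  The ambient type is a field of order \<open>q\<^sup>2\<close>, and \<open>K\<close> is its subfield of order \<open>q = card K\<close>.
  A Peisert-type graph is represented by its connection set \<open>S\<close>, the graph itself being \<open>Cay S\<close>.
\<close>

definition mult_coset :: "'a::field set \<Rightarrow> 'a \<Rightarrow> 'a set" where
  "mult_coset K c = (\<lambda>a. c * a) ` (K - {0})"

definition peisert_type :: "'a::field set \<Rightarrow> nat \<Rightarrow> 'a set \<Rightarrow> bool" where
  "peisert_type K m S \<longleftrightarrow> 1 \<le> m \<and> m \<le> card K \<and>
     (\<exists>\<C> \<subseteq> {mult_coset K c | c. c \<noteq> 0}. finite \<C> \<and> card \<C> = m \<and> S = \<Union>\<C>)"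

text \<open>
  Distinct cosets being disjoint, \<open>mult_coset K c\<close> is one of the cosets making up \<open>S\<close>
  if and only if it is contained in \<open>S\<close>.
\<close>

definition canonical_clique :: "'a::field set \<Rightarrow> 'a set \<Rightarrow> 'a set \<Rightarrow> bool" where
  "canonical_clique K S C \<longleftrightarrow>
     (\<exists>x c. c \<noteq> 0 \<and> mult_coset K c \<subseteq> S \<and> C = (\<lambda>a. x + c * a) ` K)"

definition noncanonical_clique :: "'a::field set \<Rightarrow> 'a set \<Rightarrow> 'a set \<Rightarrow> bool" where
  "noncanonical_clique K S C \<longleftrightarrow> maximum_clique (Cay S) C \<and> \<not> canonical_clique K S C"

definition strict_EKR :: "'a::field set \<Rightarrow> 'a set \<Rightarrow> bool" where
  "strict_EKR K S \<longleftrightarrow> (\<forall>C. maximum_clique (Cay S) C \<longrightarrow> canonical_clique K S C)"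

definition extremal_of_type :: "'a::field set \<Rightarrow> nat \<Rightarrow> 'a set \<Rightarrow> bool" where
  "extremal_of_type K m S \<longleftrightarrow> peisert_type K m S \<and> \<not> strict_EKR K S \<and>
     (\<forall>T. peisert_type K (m - 1) T \<longrightarrow> strict_EKR K T)"

definition extremal :: "'a::field set \<Rightarrow> 'a set \<Rightarrow> bool" where
  "extremal K S \<longleftrightarrow> (\<exists>m. extremal_of_type K m S)"

section \<open>The affine polar graph \<open>VO\<^sup>+(4, r)\<close>\<close>

definition hyperbolic_form :: "'a::field \<times> 'a \<times> 'a \<times> 'a \<Rightarrow> 'a" where
  "hyperbolic_form = (\<lambda>(z1, z2, z3, z4). z1 * z2 + z3 * z4)"

text \<open>Here \<open>K\<close> is the field of order \<open>r\<close>.\<close>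

definition VO_plus_4 :: "'a::field set \<Rightarrow> ('a \<times> 'a \<times> 'a \<times> 'a) graph" where
  "VO_plus_4 K = \<lparr>verts = K \<times> K \<times> K \<times> K,
     adj = (\<lambda>(x1, x2, x3, x4) (y1, y2, y3, y4). (x1, x2, x3, x4) \<noteq> (y1, y2, y3, y4) \<and>
              hyperbolic_form (x1 - y1, x2 - y2, x3 - y3, x4 - y4) = 0)\<rparr>"

end

theory Submission
  imports Defs "HOL-Computational_Algebra.Polynomial"
begin

text \<open>
  Let \<open>U\<close> be a non-canonical maximum clique of a graph of type \<open>(m, q)\<close> with \<open>m \<le> r + 1\<close>, where
  \<open>q = r\<^sup>2\<close>. Every direction outside the connection set meets \<open>U\<close> in one point per parallel line, so
  the lines through a point off \<open>U\<close> in the \<open>m\<close> remaining directions carry only \<open>m - 1\<close> points of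
  \<open>U\<close> in total. Counting \<open>U\<close> along the lines through one of its own points then forces \<open>m = r + 1\<close>,
  with every such line meeting \<open>U\<close> in \<open>0\<close> or \<open>r\<close> points. In coordinates adapted to three of the
  directions, \<open>U = A \<times> A\<close> for an additive group \<open>A\<close>, and the slopes of the directions are the
  multipliers of \<open>A\<close>, hence form the subfield of order \<open>r\<close>. So the extremal connection sets are the
  Baer sublines, each of which is determined by any three of its points.

  After a change of basis such a connection set becomes \<open>{(x, y) \<noteq> 0. N x = N y}\<close> with \<open>N\<close> the
  norm from the field of order \<open>q\<close> to that of order \<open>r\<close>. Here the maximum cliques through \<open>0\<close> are
  \<open>y = t x\<close> and \<open>y = t x\<^sup>r\<close> with \<open>N t = 1\<close>, and \<open>(x, y) \<mapsto> (x, t y\<^sup>r)\<close> is an automorphism that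
  exchanges the two families. The tight eigenfunctions are the difference of two cliques, one from
  each family, and the difference of the norm-one circles on the two axes.
\<close>

section \<open>Subfields and the Frobenius map\<close>

lemma subfield_0: "is_subfield M \<Longrightarrow> 0 \<in> M"
  unfolding is_subfield_def by (metis diff_self)

lemma subfield_1: "is_subfield M \<Longrightarrow> 1 \<in> M"
  unfolding is_subfield_def by blast

lemma subfield_diff: "is_subfield M \<Longrightarrow> x \<in> M \<Longrightarrow> y \<in> M \<Longrightarrow> x - y \<in> M"
  unfolding is_subfield_def by blast

lemma subfield_uminus: "is_subfield M \<Longrightarrow> x \<in> M \<Longrightarrow> - x \<in> M"
  using subfield_diff[OF _ subfield_0] by fastforce

lemma subfield_add: "is_subfield M \<Longrightarrow> x \<in> M \<Longrightarrow> y \<in> M \<Longrightarrow> x + y \<in> M"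
  using subfield_diff[OF _ _ subfield_uminus] by fastforce

lemma subfield_mult: "is_subfield M \<Longrightarrow> x \<in> M \<Longrightarrow> y \<in> M \<Longrightarrow> x * y \<in> M"
  unfolding is_subfield_def by blast

lemma subfield_inverse: "is_subfield M \<Longrightarrow> x \<in> M \<Longrightarrow> inverse x \<in> M"
  unfolding is_subfield_def by (cases "x = 0") auto

lemma subfield_divide: "is_subfield M \<Longrightarrow> x \<in> M \<Longrightarrow> y \<in> M \<Longrightarrow> x / y \<in> M"
  by (simp add: divide_inverse subfield_mult subfield_inverse)

lemma subfield_power: "is_subfield M \<Longrightarrow> x \<in> M \<Longrightarrow> x ^ n \<in> M"
  by (induction n) (auto intro: subfield_1 subfield_mult)

lemmas subfield_closed = subfield_0 subfield_1 subfield_diff subfield_uminus subfield_add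
  subfield_mult subfield_inverse subfield_divide subfield_power

text \<open>Multiplication by a nonzero \<open>x\<close> permutes \<open>M - {0}\<close>. Comparing
  the product of all nonzero elements before and after leaves a factor
  \<open>x ^ card (M - {0})\<close>, which is therefore 1.\<close>

lemma subfield_power_card:
  fixes M :: "'a::{field,finite} set"
  assumes "is_subfield M" and "x \<in> M"
  shows "x ^ card M = x"
proof (cases "x = 0")
  case True
  have "M \<noteq> {}" using assms by auto
  then show ?thesis using True by (simp add: card_gt_0_iff zero_power)
next
  case False
  let ?N = "M - {0}"
  have inj: "inj_on ((*) x) ?N" using False by (auto intro: inj_onI)
  have "(*) x ` ?N = ?N"
  proof (rule endo_inj_surj)
    show "(*) x ` ?N \<subseteq> ?N" using assms False by (auto intro: subfield_mult)
  qed (use inj in auto)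
  then have "(\<Prod>y\<in>?N. y) = (\<Prod>y\<in>?N. x * y)"
    using prod.reindex[OF inj, of "\<lambda>y. y"] by simp
  also have "\<dots> = x ^ card ?N * (\<Prod>y\<in>?N. y)" by (simp add: prod.distrib)
  finally have "x ^ card ?N = 1" by simp
  moreover have "card M = Suc (card ?N)"
    using subfield_0[OF assms(1)] by (intro card.remove) auto
  ultimately show ?thesis by (metis power_Suc mult_1_right)
qed

lemma card_power_roots_le:
  fixes a :: "'a::field"
  assumes "n > 0"
  shows "finite {x. x ^ n = a}" "card {x. x ^ n = a} \<le> n"
proof -
  let ?p = "monom 1 n - [:a:]"
  have d: "degree ?p = n"
    using assms by (subst diff_conv_add_uminus, subst degree_add_eq_left)
      (auto simp: degree_monom_eq)
  then have "?p \<noteq> 0" using assms by auto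
  moreover have "{x. poly ?p x = 0} = {x. x ^ n = a}" by (auto simp: poly_monom)
  ultimately show "finite {x. x ^ n = a}" "card {x. x ^ n = a} \<le> n"
    using card_poly_roots_bound[of ?p] poly_roots_finite[of ?p] d by auto
qed

text \<open>A polynomial equation of degree \<open>card M\<close> has no room for further roots. So
  a finite subfield is determined by its order, which is how the set of slopes is later recognised
  as \<open>k\<close>.\<close>

lemma subfield_eq_fixed_points:
  fixes M :: "'a::{field,finite} set"
  assumes "is_subfield M"
  shows "M = {x. x ^ card M = x}"
proof (rule card_seteq)
  have "{0,1} \<subseteq> M" using assms by (auto intro: subfield_closed)
  then have "card {0,1::'a} \<le> card M" by (intro card_mono) auto
  then have c: "card M \<ge> 2" by simp
  \<comment> \<open>The root 0 is split off so that the bound for pure power equations applies to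
    the others.\<close>
  have "{x::'a. x ^ card M = x} = insert 0 {x. x ^ (card M - 1) = 1}"
    using c by (cases "card M") (auto simp: power_0_left)
  then have "card {x::'a. x ^ card M = x} \<le> Suc (card {x::'a. x ^ (card M - 1) = 1})"
    by (simp add: card_insert_if)
  also have "\<dots> \<le> card M" using card_power_roots_le(2)[of "card M - 1" "1::'a"] c by simp
  finally show "card {x::'a. x ^ card M = x} \<le> card M" .
qed (use assms subfield_power_card in auto)

text \<open>On a finite set, translation by \<open>y\<close> and multiplication by a nonzero
  \<open>x\<close> are injective, hence surjective; surjectivity supplies differences and
  inverses.\<close>

lemma is_subfieldI_closed:
  fixes M :: "'a::{field,finite} set"
  assumes "1 \<in> M"
    and add: "\<And>x y. x \<in> M \<Longrightarrow> y \<in> M \<Longrightarrow> x + y \<in> M"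
    and mult: "\<And>x y. x \<in> M \<Longrightarrow> y \<in> M \<Longrightarrow> x * y \<in> M"
  shows "is_subfield M"
  unfolding is_subfield_def
proof (intro conjI ballI impI)
  show "x - y \<in> M" if "x \<in> M" "y \<in> M" for x y
  proof -
    have "(\<lambda>z. z + y) ` M = M"
      using that add by (intro endo_inj_surj) (auto intro: inj_onI)
    with that have "x \<in> (\<lambda>z. z + y) ` M" by simp
    then show ?thesis by auto
  qed
  show "inverse x \<in> M" if "x \<in> M" "x \<noteq> 0" for x
  proof -
    have "(*) x ` M = M"
      using that mult by (intro endo_inj_surj) (auto intro: inj_onI)
    with assms(1) have "1 \<in> (*) x ` M" by simp
    then obtain z where "z \<in> M" "1 = x * z" by blast
    then show ?thesis by (metis inverse_unique)
  qed
qed (use assms in auto)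

text \<open>The sum of all field elements is unchanged by \<open>z \<mapsto> z + 1\<close>, so the
  order of the field vanishes in it. Hence the characteristic divides \<open>r ^ n\<close> and is
  the prime of which \<open>r\<close> is a power.\<close>

lemma freshmans_dream_card:
  fixes x y :: "'a::{field,finite}"
  assumes "primepow r" and "card (UNIV :: 'a set) = r ^ n"
  shows "(x + y) ^ r = x ^ r + y ^ r"
proof -
  obtain p k where p: "prime p" "r = p ^ k" using assms(1) by (auto simp: primepow_def)
  have "(\<Sum>z\<in>UNIV. z + 1) = (\<Sum>z\<in>UNIV. z::'a)"
    by (rule sum.reindex_bij_witness[of _ "\<lambda>z. z - 1" "\<lambda>z. z + 1"]) auto
  then have "of_nat (card (UNIV :: 'a set)) = (0::'a)" by (simp add: sum.distrib)
  then have "CHAR('a) dvd r ^ n" using assms(2) by (metis of_nat_eq_0_iff_char_dvd)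
  moreover have prime: "prime CHAR('a)"
    by (intro prime_CHAR_semidom finite_imp_CHAR_pos) simp
  ultimately have "CHAR('a) dvd p" using p(2) prime_dvd_power by blast
  then have "CHAR('a) = p" using p(1) prime primes_dvd_imp_eq by blast
  then show ?thesis using p by (intro freshmans_dream') auto
qed

section \<open>The tower of fields of orders \<open>r\<close>, \<open>r ^ 2\<close> and
  \<open>r ^ 4\<close>\<close>

locale field_tower =
  fixes K k :: "'f::{field,finite} set" and r :: nat
  assumes primepow_r: "primepow r"
    and card_UNIV: "card (UNIV :: 'f set) = r ^ 4"
    and K: "is_subfield K" and card_K: "card K = r ^ 2"
    and k: "is_subfield k" and card_k: "card k = r"
begin

lemma r_ge_2: "r \<ge> 2"
  using primepow_gt_Suc_0[OF primepow_r] by simp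

lemma r_less_q: "r + 1 \<le> r ^ 2"
proof -
  have "2 * r \<le> r * r" using r_ge_2 by (intro mult_right_mono) auto
  then show ?thesis using r_ge_2 unfolding power2_eq_square by linarith
qed

lemma r_sq: "(r - 1) * (r + 1) = r ^ 2 - 1"
  by (simp add: power2_eq_square algebra_simps diff_mult_distrib)

lemma frobenius_add: "(x + y) ^ r = x ^ r + (y :: 'f) ^ r"
  by (rule freshmans_dream_card[OF primepow_r card_UNIV])

lemma frobenius_diff: "(x - y) ^ r = x ^ r - (y :: 'f) ^ r"
  using frobenius_add[of "x - y" y] by (simp add: algebra_simps)

lemma frobenius_frobenius: "x \<in> K \<Longrightarrow> (x ^ r) ^ r = x"
  using subfield_power_card[OF K, of x] by (simp add: card_K power2_eq_square power_mult)

lemma k_iff: "x \<in> k \<longleftrightarrow> x ^ r = x"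
  using subfield_eq_fixed_points[OF k] card_k by auto

lemma K_iff: "x \<in> K \<longleftrightarrow> x ^ (r ^ 2) = x"
  using subfield_eq_fixed_points[OF K] card_K by auto

text \<open>Inclusion follows from the orders alone: a fixed point of the \<open>r\<close>-th power
  map is a fixed point of its square.\<close>

lemma k_subset_K: "k \<subseteq> K"
  by (auto simp: k_iff K_iff power2_eq_square power_mult)

lemma in_K: "x \<in> k \<Longrightarrow> x \<in> K"
  using k_subset_K by blast

lemma norm_in_k: "x \<in> K \<Longrightarrow> x ^ (r + 1) \<in> k"
  using frobenius_frobenius[of x] by (simp add: k_iff power_mult_distrib mult.commute)

text \<open>
  The fibres have at most \<open>r + 1\<close> elements, and the \<open>r - 1\<close> of them that are not the fibre of \<open>0\<close>
  share \<open>r\<^sup>2 - 1\<close> elements.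
\<close>

lemma card_norm_fibre:
  assumes "a \<in> k" "a \<noteq> 0"
  shows "card {t \<in> K. t ^ (r + 1) = a} = r + 1"
proof -
  let ?f = "\<lambda>a. {t \<in> K. t ^ (r + 1) = a}"
  have le: "card (?f a) \<le> r + 1" for a
  proof -
    have "card (?f a) \<le> card {t. t ^ (r + 1) = a}"
      by (rule card_mono) auto
    also have "\<dots> \<le> r + 1" by (rule card_power_roots_le) simp
    finally show ?thesis .
  qed
  have un: "K - {0} = (\<Union>a\<in>k - {0}. ?f a)"
    using norm_in_k by auto
  have "(\<Sum>a\<in>k - {0}. card (?f a)) = card (K - {0})"
    unfolding un by (rule card_UN_disjoint[symmetric]) auto
  also have "\<dots> = (\<Sum>a\<in>k - {0}. r + 1)"
    using r_sq subfield_0[OF K] subfield_0[OF k]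
    by (simp add: card_K card_k card_Diff_singleton)
  finally have "(\<Sum>a\<in>k - {0}. card (?f a)) = (\<Sum>a\<in>k - {0}. r + 1)" .
  from sum_mono_inv[OF this le] show ?thesis using assms by auto
qed

lemma card_norm_1: "card {t \<in> K. t ^ (r + 1) = 1} = r + 1"
  using card_norm_fibre[of 1] subfield_1[OF k] by simp

end

section \<open>Directions in the affine plane over \<open>K\<close>\<close>

definition line :: "'a::field set \<Rightarrow> 'a \<Rightarrow> 'a set" where
  "line K c = (\<lambda>a. c * a) ` K"

text \<open>For a subfield \<open>K\<close> these are the points of the projective line over
  \<open>K\<close>. Each keeps its 0, so that it is an additive group, unlike the cosets
  \<open>mult_coset K c\<close>.\<close>

definition directions :: "'a::field set \<Rightarrow> 'a set set" where
  "directions K = line K ` (UNIV - {0})"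

definition directions_in :: "'a::field set \<Rightarrow> 'a set \<Rightarrow> 'a set set" where
  "directions_in K S = {L \<in> directions K. L - {0} \<subseteq> S}"

definition indep :: "'a::field set \<Rightarrow> 'a \<Rightarrow> 'a \<Rightarrow> bool" where
  "indep K u v \<longleftrightarrow> (\<forall>a\<in>K. \<forall>b\<in>K. u * a + v * b = 0 \<longrightarrow> a = 0 \<and> b = 0)"

lemma indepD: "indep K u v \<Longrightarrow> a \<in> K \<Longrightarrow> b \<in> K \<Longrightarrow> u * a + v * b = 0 \<Longrightarrow> a = 0 \<and> b = 0"
  unfolding indep_def by blast

context field_tower
begin

lemma line_0: "0 \<in> line K c"
  unfolding line_def using subfield_0[OF K] by force

lemma line_self: "c \<in> line K c"
  unfolding line_def using subfield_1[OF K] by force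

lemma line_diff: "x \<in> line K c \<Longrightarrow> y \<in> line K c \<Longrightarrow> x - y \<in> line K c"
  unfolding line_def using subfield_diff[OF K]
  by (auto simp: right_diff_distrib[symmetric])

lemma line_scale: "x \<in> line K c \<Longrightarrow> a \<in> K \<Longrightarrow> x * a \<in> line K c"
  unfolding line_def using subfield_mult[OF K] by (auto simp: mult.assoc)

lemma mult_in_line: "a \<in> K \<Longrightarrow> c * a \<in> line K c"
  unfolding line_def by blast

lemma mult_coset_eq: "c \<noteq> 0 \<Longrightarrow> mult_coset K c = line K c - {0}"
  unfolding mult_coset_def line_def by auto

lemma line_subset: "z \<in> line K c \<Longrightarrow> line K z \<subseteq> line K c"
  using line_scale unfolding line_def[of K z] by blast

lemma line_eqI:
  assumes "z \<in> line K c" "z \<noteq> 0"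
  shows "line K z = line K c"
proof -
  obtain a where a: "a \<in> K" "z = c * a" using assms(1) by (auto simp: line_def)
  then have "a \<noteq> 0" using assms(2) by auto
  then have "c = z * inverse a" using a by simp
  then have "c \<in> line K z" by (metis mult_in_line subfield_inverse[OF K a(1)])
  then show ?thesis using line_subset assms(1) by blast
qed

lemma directions_line: "c \<noteq> 0 \<Longrightarrow> line K c \<in> directions K"
  unfolding directions_def by blast

lemma directions_eq: "L \<in> directions K \<Longrightarrow> z \<in> L \<Longrightarrow> z \<noteq> 0 \<Longrightarrow> L = line K z"
  unfolding directions_def using line_eqI by auto

lemma directions_0: "L \<in> directions K \<Longrightarrow> 0 \<in> L"
  unfolding directions_def using line_0 by auto

lemma directions_diff: "L \<in> directions K \<Longrightarrow> x \<in> L \<Longrightarrow> y \<in> L \<Longrightarrow> x - y \<in> L"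
  unfolding directions_def using line_diff by auto

lemma directions_uminus: "L \<in> directions K \<Longrightarrow> x \<in> L \<Longrightarrow> - x \<in> L"
  by (metis diff_0 directions_diff directions_0)

lemma directions_add: "L \<in> directions K \<Longrightarrow> x \<in> L \<Longrightarrow> y \<in> L \<Longrightarrow> x + y \<in> L"
  by (metis diff_minus_eq_add directions_diff directions_uminus)

lemma card_line: "c \<noteq> 0 \<Longrightarrow> card (line K c) = r ^ 2"
  unfolding line_def by (subst card_image) (auto intro: inj_onI simp: card_K)

lemma card_direction: "L \<in> directions K \<Longrightarrow> card L = r ^ 2"
  unfolding directions_def using card_line by auto

lemma card_direction_minus_0: "L \<in> directions K \<Longrightarrow> card (L - {0}) = r ^ 2 - 1"
  using card_direction directions_0 by (simp add: card_Diff_singleton)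

lemma directions_disjoint:
  "L \<in> directions K \<Longrightarrow> M \<in> directions K \<Longrightarrow> L \<noteq> M \<Longrightarrow> L \<inter> M = {0}"
  using directions_eq directions_0 by blast

lemma card_Union_directions:
  assumes "D \<subseteq> directions K"
  shows "card (\<Union>D - {0}) = card D * (r ^ 2 - 1)"
proof -
  have "\<Union>D - {0} = (\<Union>L\<in>D. L - {0})" by auto
  also have "card \<dots> = (\<Sum>L\<in>D. card (L - {0}))"
  proof (rule card_UN_disjoint)
    show "\<forall>i\<in>D. \<forall>j\<in>D. i \<noteq> j \<longrightarrow> (i - {0}) \<inter> (j - {0}) = {}"
      using directions_disjoint assms by blast
  qed auto
  also have "\<dots> = (\<Sum>L\<in>D. r ^ 2 - 1)"
    using card_direction_minus_0 assms by (intro sum.cong) auto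
  finally show ?thesis by simp
qed

lemma Union_directions: "\<Union>(directions K) = UNIV"
proof -
  have "z \<in> \<Union>(directions K)" for z
    using directions_line[of z] line_self[of z] directions_line[of 1] line_0[of 1]
    by (cases "z = 0") auto
  then show ?thesis by blast
qed

text \<open>The \<open>r ^ 4 - 1\<close> nonzero vectors are partitioned into blocks of size
  \<open>r ^ 2 - 1\<close>, one for each direction.\<close>

lemma card_directions: "card (directions K) = r ^ 2 + 1"
proof -
  have "card (directions K) * (r ^ 2 - 1) = r ^ 4 - 1"
    using card_Union_directions[of "directions K"]
    by (simp add: Union_directions card_UNIV card_Diff_singleton)
  also have "\<dots> = (r ^ 2 + 1) * (r ^ 2 - 1)"
    by (simp add: algebra_simps flip: power_add)
  finally show ?thesis by (rule mult_right_cancel[THEN iffD1, rotated]) (use r_less_q r_ge_2 in simp)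
qed

text \<open>Any nonzero point determines its direction, so a set of directions can be read off from
  its union. With \<open>peisert_typeD\<close> this turns statements about connection sets into
  statements about sets of directions.\<close>

lemma directions_in_Union:
  assumes "D \<subseteq> directions K"
  shows "directions_in K (\<Union>D - {0}) = D"
proof -
  have "L \<in> D" if "L \<in> directions K" "L - {0} \<subseteq> \<Union>D - {0}" for L
  proof -
    obtain c where c: "c \<noteq> 0" "L = line K c" using \<open>L \<in> directions K\<close> by (auto simp: directions_def)
    then have "c \<in> L - {0}" using line_self by auto
    then obtain M where "M \<in> D" "c \<in> M" using \<open>L - {0} \<subseteq> _\<close> by blast
    then show ?thesis using directions_eq[of M c] assms c by auto
  qed
  then show ?thesis using assms unfolding directions_in_def by blast
qed

lemma directions_in_subset: "directions_in K S \<subseteq> directions K"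
  unfolding directions_in_def by blast

lemma directions_in_mono: "S \<subseteq> T \<Longrightarrow> directions_in K S \<subseteq> directions_in K T"
  unfolding directions_in_def by blast

section \<open>Connection sets as sets of directions\<close>

lemma peisert_type_Union:
  assumes "D \<subseteq> directions K" "1 \<le> card D" "card D \<le> r ^ 2"
  shows "peisert_type K (card D) (\<Union>D - {0})"
proof -
  let ?C = "(\<lambda>L. L - {0}) ` D"
  have "inj_on (\<lambda>L. L - {0}) D"
    using directions_0 assms(1) by (intro inj_onI) (metis insert_Diff subsetD)
  then have "card ?C = card D" by (rule card_image)
  moreover have "?C \<subseteq> {mult_coset K c | c. c \<noteq> 0}"
    using assms(1) by (auto simp: directions_def dest!: subsetD) (use mult_coset_eq in blast)
  moreover have "\<Union>D - {0} = \<Union>?C" by auto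
  ultimately show ?thesis unfolding peisert_type_def using assms by (auto simp: card_K)
qed

lemma peisert_typeD:
  assumes "peisert_type K m S"
  shows "S = \<Union>(directions_in K S) - {0}" "card (directions_in K S) = m"
    "1 \<le> m" "m \<le> r ^ 2"
proof -
  obtain C where C: "C \<subseteq> {mult_coset K c | c. c \<noteq> 0}" "card C = m" "S = \<Union>C"
    using assms by (auto simp: peisert_type_def)
  define D where "D = insert 0 ` C"
  have n0: "0 \<notin> X" if "X \<in> C" for X
    using that C(1) by (auto simp: mult_coset_def)
  have D: "D \<subseteq> directions K"
  proof
    fix L assume "L \<in> D"
    then obtain c where "c \<noteq> 0" "L = insert 0 (mult_coset K c)" using C(1) by (auto simp: D_def)
    then have "L = line K c" using mult_coset_eq line_0 by auto
    then show "L \<in> directions K" using directions_line \<open>c \<noteq> 0\<close> by simp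
  qed
  have "card D = m"
    unfolding D_def C(2)[symmetric] using n0 by (intro card_image inj_onI) (metis Diff_insert_absorb)
  moreover have "S = \<Union>D - {0}" using n0 C(3) by (auto simp: D_def)
  ultimately show "S = \<Union>(directions_in K S) - {0}" "card (directions_in K S) = m"
    using directions_in_Union[OF D] by auto
  show "1 \<le> m" "m \<le> r ^ 2" using assms by (auto simp: peisert_type_def card_K)
qed

lemma card_peisert: "peisert_type K m S \<Longrightarrow> card S = m * (r ^ 2 - 1)"
  using card_Union_directions[OF directions_in_subset, of S] peisert_typeD[of m S] by metis

lemma in_peisert_iff:
  assumes "peisert_type K m S"
  shows "z \<in> S \<longleftrightarrow> z \<noteq> 0 \<and> line K z \<in> directions_in K S"
proof
  assume "z \<in> S"
  then obtain L where "L \<in> directions_in K S" "z \<in> L" "z \<noteq> 0"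
    using peisert_typeD(1)[OF assms] by blast
  then show "z \<noteq> 0 \<and> line K z \<in> directions_in K S"
    using directions_eq[of L z] directions_in_subset by auto
next
  assume "z \<noteq> 0 \<and> line K z \<in> directions_in K S"
  then show "z \<in> S" using peisert_typeD(1)[OF assms] line_self by blast
qed

lemma peisert_scale:
  assumes "peisert_type K m S" "z \<in> S" "a \<in> K" "a \<noteq> 0"
  shows "z * a \<in> S"
proof -
  have "z \<noteq> 0" using assms in_peisert_iff by blast
  then have "line K (z * a) = line K z" "z * a \<noteq> 0"
    using line_eqI[of "z * a" z] mult_in_line assms by auto
  then show ?thesis using assms in_peisert_iff by simp
qed

lemma peisert_uminus: "peisert_type K m S \<Longrightarrow> - z \<in> S \<longleftrightarrow> z \<in> S"
  using peisert_scale[of m S z "-1"] peisert_scale[of m S "-z" "-1"] subfield_uminus[OF K subfield_1[OF K]]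
  by auto

lemma peisert_no_0: "peisert_type K m S \<Longrightarrow> 0 \<notin> S"
  using in_peisert_iff by blast

lemma peisert_commute: "peisert_type K m S \<Longrightarrow> x - y \<in> S \<longleftrightarrow> y - x \<in> S"
  using peisert_uminus[of m S "x - y"] by simp

section \<open>Coordinates with respect to a basis over \<open>K\<close>\<close>

lemma indep_nonzero: "indep K u v \<Longrightarrow> u \<noteq> 0 \<and> v \<noteq> 0"
  using indepD[of K u v 1 0] indepD[of K u v 0 1] subfield_0[OF K] subfield_1[OF K] by auto

lemma indep_cancel:
  assumes "indep K u v" "a \<in> K" "b \<in> K" "c \<in> K" "d \<in> K"
    and "u * a + v * b = u * c + v * d"
  shows "a = c \<and> b = d"
  using indepD[of K u v "a - c" "b - d"] assms subfield_diff[OF K] by (auto simp: algebra_simps)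

lemma indep_lines:
  assumes "u \<noteq> 0" "v \<noteq> 0" "line K u \<noteq> line K v"
  shows "indep K u v"
  unfolding indep_def
proof (intro ballI impI)
  fix a b assume ab: "a \<in> K" "b \<in> K" and e: "u * a + v * b = 0"
  have "u * a = v * (- b)" using e by (simp add: eq_neg_iff_add_eq_0)
  then have "u * a \<in> line K u" "u * a \<in> line K v"
    using mult_in_line[of a u] mult_in_line[of "-b" v] ab subfield_uminus[OF K] by auto
  then have "u * a = 0" using line_eqI assms(3) by metis
  then show "a = 0 \<and> b = 0" using e assms by auto
qed

lemma indep_bij:
  assumes "indep K u v"
  shows "bij_betw (\<lambda>(x, y). u * x + v * y) (K \<times> K) UNIV"
proof -
  have inj: "inj_on (\<lambda>(x, y). u * x + v * y) (K \<times> K)"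
    using indep_cancel[OF assms] by (auto intro!: inj_onI)
  moreover have "(\<lambda>(x, y). u * x + v * y) ` (K \<times> K) = UNIV"
    by (rule card_subset_eq) (auto simp: card_image[OF inj] card_K card_cartesian_product card_UNIV simp flip: power_add)
  ultimately show ?thesis by (simp add: bij_betw_def)
qed

lemma indep_coords:
  assumes "indep K u v"
  obtains x y where "x \<in> K" "y \<in> K" "z = u * x + v * y"
proof -
  have "z \<in> (\<lambda>(x, y). u * x + v * y) ` (K \<times> K)"
    using indep_bij[OF assms] by (simp add: bij_betw_def)
  then show ?thesis using that by auto
qed

lemma exists_indep: obtains u v where "indep K u v"
proof -
  have "card (directions K) > 1" using card_directions r_ge_2 by simp
  then obtain L M where "L \<in> directions K" "M \<in> directions K" "L \<noteq> M"
    using card_le_Suc0_iff_eq[of "directions K"] by auto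
  then show ?thesis using indep_lines that by (auto simp: directions_def)
qed

section \<open>Counting the points of a set along lines\<close>

lemma sum_over_directions:
  "(\<Sum>L\<in>directions K. card {u \<in> U. u \<noteq> R \<and> u - R \<in> L}) = card (U - {R})"
proof -
  have "U - {R} = (\<Union>L\<in>directions K. {u \<in> U. u \<noteq> R \<and> u - R \<in> L})"
    using Union_directions by auto
  also have "card \<dots> = (\<Sum>L\<in>directions K. card {u \<in> U. u \<noteq> R \<and> u - R \<in> L})"
  proof (rule card_UN_disjoint)
    have "i = j" if "i \<in> directions K" "j \<in> directions K" "u - R \<in> i" "u - R \<in> j" "u \<noteq> R" for i j u
      using directions_eq[of i "u - R"] directions_eq[of j "u - R"] that by simp
    then show "\<forall>i\<in>directions K. \<forall>j\<in>directions K. i \<noteq> j \<longrightarrow>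
      {u \<in> U. u \<noteq> R \<and> u - R \<in> i} \<inter> {u \<in> U. u \<noteq> R \<and> u - R \<in> j} = {}"
      by blast
  qed auto
  finally show ?thesis by simp
qed

text \<open>If no difference of points of \<open>U\<close> lies in \<open>L\<close>, then distinct
  points of \<open>U\<close> lie on distinct parallels of \<open>L\<close>.\<close>

lemma transversal_inj:
  assumes "L \<in> directions K"
    and "\<And>u w. u \<in> U \<Longrightarrow> w \<in> U \<Longrightarrow> u \<noteq> w \<Longrightarrow> u - w \<notin> L"
  shows "inj_on (\<lambda>(u, l). u - l) (U \<times> L)"
proof (rule inj_onI, clarify)
  fix u l w m assume *: "u \<in> U" "l \<in> L" "w \<in> U" "m \<in> L" "u - l = w - m"
  then have "u - w = l - m" by (simp add: algebra_simps)
  then have "u - w \<in> L" using directions_diff assms(1) * by simp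
  then have "u = w" using assms(2) * by blast
  then show "u = w \<and> l = m" using * by simp
qed

text \<open>With \<open>r ^ 2\<close> points in \<open>U\<close>, the \<open>r ^ 2 * r ^ 2\<close>
  differences \<open>u - l\<close> are distinct and exhaust the plane, so no parallel of
  \<open>L\<close> is missed.\<close>

lemma transversal:
  assumes "L \<in> directions K" "card U = r ^ 2"
    and "\<And>u w. u \<in> U \<Longrightarrow> w \<in> U \<Longrightarrow> u \<noteq> w \<Longrightarrow> u - w \<notin> L"
  shows "card {u \<in> U. u - z \<in> L} = 1"
proof -
  note inj = transversal_inj[OF assms(1,3)]
  have "(\<lambda>(u, l). u - l) ` (U \<times> L) = UNIV"
    by (rule card_subset_eq)
      (auto simp: card_image[OF inj] card_cartesian_product card_UNIV assms(2)
        card_direction[OF assms(1)] simp flip: power_add)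
  then have "z \<in> (\<lambda>(u, l). u - l) ` (U \<times> L)" by simp
  then obtain u l where u: "u \<in> U" "l \<in> L" "z = u - l" by auto
  have "w = u" if "w \<in> U" "w - z \<in> L" for w
  proof (rule ccontr)
    assume "w \<noteq> u"
    moreover have "w - u = w - z - l" using u by simp
    then have "w - u \<in> L" using directions_diff[OF assms(1) that(2) u(2)] by (simp only:)
    ultimately show False using assms(3) that u by blast
  qed
  then have "{u \<in> U. u - z \<in> L} = {u}" using u by auto
  then show ?thesis by simp
qed

end

section \<open>Cliques determining few directions\<close>

context field_tower
begin

text \<open>A non-canonical clique is described here by its points and differences only. The third
  claim, that at most one line in an \<open>S\<close>-direction through a point off \<open>U\<close>
  meets \<open>U\<close>, later makes \<open>U\<close> a product set.\<close>

lemma noncanonical_line_meets: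
  assumes S: "peisert_type K m S" "m \<le> r + 1"
    and cU: "card U = r ^ 2"
    and clique: "\<And>u w. u \<in> U \<Longrightarrow> w \<in> U \<Longrightarrow> u \<noteq> w \<Longrightarrow> u - w \<in> S"
    and not_line: "\<And>L x. L \<in> directions_in K S \<Longrightarrow> U \<noteq> (+) x ` L"
  shows "m = r + 1"
    and "\<And>L p. L \<in> directions_in K S \<Longrightarrow> p \<in> U \<Longrightarrow> card {u \<in> U. u - p \<in> L} = r"
    and "\<And>R L M. R \<notin> U \<Longrightarrow> L \<in> directions_in K S \<Longrightarrow> M \<in> directions_in K S \<Longrightarrow>
      \<exists>u\<in>U. u - R \<in> L \<Longrightarrow> \<exists>u\<in>U. u - R \<in> M \<Longrightarrow> L = M"
proof -
  let ?D = "directions_in K S"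
  define n where "n L R = card {u \<in> U. u - R \<in> L}" for L R
  have D: "?D \<subseteq> directions K" by (rule directions_in_subset)
  have cD: "card ?D = m" using peisert_typeD(2)[OF S(1)] .
  have split: "(\<Sum>L\<in>directions K. f L) = (\<Sum>L\<in>?D. f L) + (\<Sum>L\<in>directions K - ?D. f L)" for f :: "_ \<Rightarrow> nat"
    by (rule sum.subset_diff[OF D, simplified add.commute]) simp
  \<comment> \<open>A direction outside \<open>S\<close> contains no difference of points of
    \<open>U\<close>, so \<open>transversal\<close> applies to it.\<close>
  have off: "u - w \<notin> L" if "L \<in> directions K - ?D" "u \<in> U" "w \<in> U" "u \<noteq> w" for L u w
  proof
    assume "u - w \<in> L"
    moreover have "u - w \<noteq> 0" using that by simp
    ultimately have "L = line K (u - w)" using directions_eq that by blast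
    then show False using in_peisert_iff[OF S(1)] clique[of u w] that by auto
  qed
  \<comment> \<open>From \<open>R\<close> all \<open>r ^ 2\<close> points of \<open>U\<close> are
    seen. Each of the \<open>r ^ 2 + 1 - m\<close> directions outside \<open>S\<close> accounts for
    exactly one of them, which leaves \<open>m - 1\<close>.\<close>
  have outside: "(\<Sum>L\<in>?D. n L R) = m - 1" if "R \<notin> U" for R
  proof -
    have "{u \<in> U. u \<noteq> R \<and> u - R \<in> L} = {u \<in> U. u - R \<in> L}" for L using that by auto
    then have "(\<Sum>L\<in>directions K. n L R) = r ^ 2"
      using sum_over_directions[of U R] that by (simp add: n_def cU)
    moreover have "(\<Sum>L\<in>directions K - ?D. n L R) = (\<Sum>L\<in>directions K - ?D. 1)"
      unfolding n_def using transversal[OF _ cU] off by (intro sum.cong) auto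
    moreover have "card (directions K - ?D) = r ^ 2 + 1 - m"
      using D by (simp add: card_Diff_subset cD card_directions)
    ultimately show ?thesis using split[of "\<lambda>L. n L R"] peisert_typeD[OF S(1)] by simp
  qed
  \<comment> \<open>The line through \<open>p\<close> has a point off \<open>U\<close>, since
    otherwise it would be all of \<open>U\<close>. Seen from that point, its points of
    \<open>U\<close> are among only \<open>m - 1 \<le> r\<close>.\<close>
  have less: "n L p \<le> r" if "L \<in> ?D" "p \<in> U" for L p
  proof -
    have L: "L \<in> directions K" using that D by blast
    have "\<not> (+) p ` L \<subseteq> U"
    proof
      assume "(+) p ` L \<subseteq> U"
      then have "(+) p ` L = U"
        by (intro card_subset_eq) (auto simp: card_image card_direction[OF L] cU)
      then show False using not_line that by blast
    qed
    then obtain l where l: "l \<in> L" "p + l \<notin> U" by auto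
    have "u - p \<in> L \<longleftrightarrow> u - (p + l) \<in> L" for u
      using directions_diff[OF L, of "u - p" l] directions_add[OF L, of "u - (p + l)" l] l
      by (auto simp: algebra_simps)
    then have "n L p = n L (p + l)" by (simp add: n_def)
    also have "\<dots> \<le> (\<Sum>L\<in>?D. n L (p + l))" by (rule member_le_sum) (use that in auto)
    also have "\<dots> \<le> r" using outside[OF l(2)] S(2) by simp
    finally show ?thesis .
  qed
  \<comment> \<open>From a point of \<open>U\<close> the directions outside \<open>S\<close> show
    nothing else; the \<open>- 1\<close> in each term removes \<open>p\<close> itself.\<close>
  have inside: "(\<Sum>L\<in>?D. n L p - 1) = r ^ 2 - 1" if p: "p \<in> U" for p
  proof -
    have "n L p - 1 = card {u \<in> U. u \<noteq> p \<and> u - p \<in> L}" if "L \<in> ?D" for L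
    proof -
      have "{u \<in> U. u \<noteq> p \<and> u - p \<in> L} = {u \<in> U. u - p \<in> L} - {p}" by auto
      moreover have "p \<in> {u \<in> U. u - p \<in> L}" using p directions_0 D that by auto
      ultimately show ?thesis by (simp add: n_def card_Diff_singleton)
    qed
    moreover have "(\<Sum>L\<in>directions K - ?D. card {u \<in> U. u \<noteq> p \<and> u - p \<in> L}) = 0"
      using off p by (intro sum.neutral) auto
    ultimately show ?thesis
      using split[of "\<lambda>L. card {u \<in> U. u \<noteq> p \<and> u - p \<in> L}"] sum_over_directions[of U p] p
      by (simp add: card_Diff_singleton cU)
  qed
  obtain p0 where p0: "p0 \<in> U" using cU r_ge_2 by fastforce
  \<comment> \<open>The \<open>(r + 1) * (r - 1)\<close> other points are spread over
    \<open>m\<close> directions holding at most \<open>r - 1\<close> each, so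
    \<open>m \<ge> r + 1\<close>. With \<open>m = r + 1\<close> every one of these bounds is
    attained.\<close>
  have "r ^ 2 - 1 = (\<Sum>L\<in>?D. n L p0 - 1)" using inside[OF p0] by simp
  also have "\<dots> \<le> (\<Sum>L\<in>?D. r - 1)" by (intro sum_mono diff_le_mono less p0)
  finally have "(r + 1) * (r - 1) \<le> m * (r - 1)" using r_sq by (simp add: cD mult.commute)
  then have "r + 1 \<le> m" by (rule mult_le_cancel2[THEN iffD1, rule_format]) (use r_ge_2 in simp)
  then show m: "m = r + 1" using S(2) by simp
  show rich: "card {u \<in> U. u - p \<in> L} = r" if L: "L \<in> ?D" and p: "p \<in> U" for L p
  proof -
    have "(\<Sum>L\<in>?D. n L p - 1) = (\<Sum>L\<in>?D. r - 1)"
      using inside[OF p] m cD r_sq by (simp add: mult.commute)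
    from sum_mono_inv[OF this _ L] have "n L p - 1 = r - 1"
      using less p by (simp add: diff_le_mono)
    then show ?thesis using r_ge_2 unfolding n_def by linarith
  qed
  \<comment> \<open>Two different lines through \<open>R\<close> that meet \<open>U\<close> would
    carry \<open>2 * r\<close> points, but only \<open>m - 1 = r\<close> are available.\<close>
  show "L = M" if R: "R \<notin> U" and L: "L \<in> ?D" and M: "M \<in> ?D"
    and u: "\<exists>u\<in>U. u - R \<in> L" "\<exists>u\<in>U. u - R \<in> M" for R L M
  proof (rule ccontr)
    assume "L \<noteq> M"
    have n_r: "n N R = r" if N: "N \<in> ?D" and ex: "\<exists>u\<in>U. u - R \<in> N" for N
    proof -
      obtain w where w: "w \<in> U" "w - R \<in> N" using ex by blast
      have ND: "N \<in> directions K" using N D by blast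
      have "u - R \<in> N \<longleftrightarrow> u - w \<in> N" for u
        using directions_diff[OF ND, of "u - R" "w - R"] directions_add[OF ND, of "u - w" "w - R"] w
        by auto
      then show ?thesis using rich[OF N w(1)] by (simp add: n_def)
    qed
    have "n L R + n M R = (\<Sum>N\<in>{L, M}. n N R)" using \<open>L \<noteq> M\<close> by simp
    also have "\<dots> \<le> (\<Sum>N\<in>?D. n N R)" using L M by (intro sum_mono2) auto
    also have "\<dots> = r" using outside[OF R] m by simp
    finally show False using n_r[OF L u(1)] n_r[OF M u(2)] r_ge_2 by simp
  qed
qed

end

text \<open>For independent \<open>u\<close> and \<open>v\<close> this is a Baer subline of the
  projective line over \<open>K\<close>, stored as the set of nonzero vectors on its points.\<close>

definition baer :: "'a::field set \<Rightarrow> 'a set \<Rightarrow> 'a \<Rightarrow> 'a \<Rightarrow> 'a set" where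
  "baer K k u v = {x * (u * a + v * b) | x a b. x \<in> K - {0} \<and> a \<in> k \<and> b \<in> k \<and> (a \<noteq> 0 \<or> b \<noteq> 0)}"

lemma baerI:
  "x \<in> K \<Longrightarrow> x \<noteq> 0 \<Longrightarrow> a \<in> k \<Longrightarrow> b \<in> k \<Longrightarrow> a \<noteq> 0 \<or> b \<noteq> 0 \<Longrightarrow>
    x * (u * a + v * b) \<in> baer K k u v"
  unfolding baer_def by blast

lemma clique_Cay: "clique (Cay S) C \<longleftrightarrow> (\<forall>x\<in>C. \<forall>y\<in>C. x \<noteq> y \<longrightarrow> x - y \<in> S)"
  by (simp add: clique_def Cay_def)

lemma clique_Cay_translate: "clique (Cay S) ((+) x ` C) \<longleftrightarrow> clique (Cay S) C"
  by (auto simp: clique_Cay)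

section \<open>Maximum cliques and Baer sublines\<close>

context field_tower
begin

lemma directionsE:
  assumes "L \<in> directions K"
  obtains c where "c \<noteq> 0" "L = line K c"
  using assms by (auto simp: directions_def)

lemma canonical_clique_iff:
  "canonical_clique K S C \<longleftrightarrow> (\<exists>x. \<exists>L\<in>directions_in K S. C = (+) x ` L)"
proof
  assume "canonical_clique K S C"
  then obtain x c where "c \<noteq> 0" "mult_coset K c \<subseteq> S" "C = (\<lambda>a. x + c * a) ` K"
    by (auto simp: canonical_clique_def)
  then have "line K c \<in> directions_in K S" "C = (+) x ` line K c"
    using directions_line[of c] mult_coset_eq[of c] by (auto simp: directions_in_def line_def)
  then show "\<exists>x. \<exists>L\<in>directions_in K S. C = (+) x ` L" by blast
next
  assume "\<exists>x. \<exists>L\<in>directions_in K S. C = (+) x ` L"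
  then obtain x L where L: "L \<in> directions_in K S" "C = (+) x ` L" by blast
  then obtain c where c: "c \<noteq> 0" "L = line K c"
    by (auto simp: directions_in_def directions_def)
  then have "mult_coset K c \<subseteq> S" using L mult_coset_eq[of c] by (auto simp: directions_in_def)
  moreover have "C = (\<lambda>a. x + c * a) ` K" using L c by (auto simp: line_def)
  ultimately show "canonical_clique K S C" unfolding canonical_clique_def using c by blast
qed

lemma line_clique:
  assumes "L \<in> directions_in K S"
  shows "clique (Cay S) ((+) x ` L)"
  unfolding clique_Cay_translate
  using assms directions_diff[of L] by (auto simp: clique_Cay directions_in_def)

text \<open>Since \<open>m \<le> r ^ 2\<close>, some direction lies outside \<open>S\<close>. A
  clique has at most one point on each of its \<open>r ^ 2\<close> parallels.\<close>

lemma card_clique_le: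
  assumes "peisert_type K m S" "clique (Cay S) C"
  shows "card C \<le> r ^ 2"
proof -
  have "card (directions_in K S) < card (directions K)"
    using peisert_typeD[OF assms(1)] by (simp add: card_directions)
  then obtain L where L: "L \<in> directions K" "L \<notin> directions_in K S"
    using directions_in_subset by (metis less_irrefl subsetI subset_antisym)
  have "u - w \<notin> L" if "u \<in> C" "w \<in> C" "u \<noteq> w" for u w
  proof
    assume "u - w \<in> L"
    then have "L = line K (u - w)" using directions_eq L that by simp
    moreover have "u - w \<in> S" using that assms(2) by (simp add: clique_Cay)
    ultimately show False using in_peisert_iff[OF assms(1)] L by auto
  qed
  from card_image[OF transversal_inj[OF L(1) this]]
  have "card C * r ^ 2 = card ((\<lambda>(u, l). u - l) ` (C \<times> L))"
    by (simp add: card_cartesian_product card_direction[OF L(1)])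
  also have "\<dots> \<le> r ^ 2 * r ^ 2"
    using card_mono[of UNIV "(\<lambda>(u, l). u - l) ` (C \<times> L)"]
    by (simp add: card_UNIV flip: power_add)
  finally show ?thesis by (rule mult_right_le_imp_le) (use r_ge_2 in simp)
qed

lemma maximum_clique_iff:
  assumes "peisert_type K m S"
  shows "maximum_clique (Cay S) C \<longleftrightarrow> clique (Cay S) C \<and> card C = r ^ 2"
proof -
  have "directions_in K S \<noteq> {}"
    using peisert_typeD[OF assms] by force
  then obtain L where L: "L \<in> directions_in K S" by blast
  then have "clique (Cay S) ((+) 0 ` L)" "card ((+) 0 ` L) = r ^ 2"
    using line_clique[OF L] card_direction[of L] directions_in_subset[of S] L
    by (blast, auto simp: card_image)
  then show ?thesis
    using card_clique_le[OF assms] unfolding maximum_clique_def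
    by (metis finite dual_order.antisym)
qed

text \<open>The ratio \<open>x / y\<close> lies in \<open>k\<close> exactly when Frobenius fixes it.
  Clearing denominators gives an equation that also covers the axes.\<close>

lemma baer_iff:
  assumes "indep K u v" "x \<in> K" "y \<in> K"
  shows "u * x + v * y \<in> baer K k u v \<longleftrightarrow> (x \<noteq> 0 \<or> y \<noteq> 0) \<and> x ^ r * y = x * y ^ r"
proof
  assume "u * x + v * y \<in> baer K k u v"
  then obtain c a b where c: "c \<in> K" "c \<noteq> 0" "a \<in> k" "b \<in> k" "a \<noteq> 0 \<or> b \<noteq> 0"
    "u * x + v * y = c * (u * a + v * b)" by (auto simp: baer_def)
  then have "u * x + v * y = u * (c * a) + v * (c * b)" by (simp add: algebra_simps)
  moreover have "c * a \<in> K" "c * b \<in> K" using c in_K subfield_mult[OF K] by auto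
  ultimately have "x = c * a \<and> y = c * b" using indep_cancel[OF assms] by simp
  moreover have "a ^ r = a" "b ^ r = b" using c k_iff by auto
  ultimately show "(x \<noteq> 0 \<or> y \<noteq> 0) \<and> x ^ r * y = x * y ^ r"
    using c by (auto simp: power_mult_distrib)
next
  assume R: "(x \<noteq> 0 \<or> y \<noteq> 0) \<and> x ^ r * y = x * y ^ r"
  show "u * x + v * y \<in> baer K k u v"
  proof (cases "y = 0")
    case True
    then show ?thesis
      using baerI[of x K 1 k 0 u v] R True assms subfield_0[OF k] subfield_1[OF k]
      by (simp add: mult.commute)
  next
    case False
    have "(x / y) ^ r = x / y" using R False by (simp add: field_simps)
    then have "x / y \<in> k" by (simp add: k_iff)
    moreover have "y * (u * (x / y) + v * 1) = u * x + v * y" using False by (simp add: field_simps)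
    ultimately show ?thesis using baerI[of y K "x / y" k 1 u v] False assms subfield_1[OF k] by simp
  qed
qed

text \<open>The slopes of a Baer subline: the elements of \<open>k\<close>, with
  \<open>line K v\<close> as the slope at infinity.\<close>

definition baer_directions :: "'f \<Rightarrow> 'f \<Rightarrow> 'f set set" where
  "baer_directions u v = insert (line K v) ((\<lambda>a. line K (u + v * a)) ` k)"

lemma slope_nonzero: "indep K u v \<Longrightarrow> a \<in> K \<Longrightarrow> u + v * a \<noteq> 0"
  using indepD[of K u v 1 a] subfield_1[OF K] by auto

lemma slope_inj:
  assumes "indep K u v" "a \<in> K" "b \<in> K" "line K (u + v * a) = line K (u + v * b)"
  shows "a = b"
proof -
  obtain c where c: "c \<in> K" "u + v * a = (u + v * b) * c"
    using assms(4) line_self[of "u + v * a"] by (auto simp: line_def)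
  then have "u * 1 + v * a = u * c + v * (b * c)" by (simp add: algebra_simps)
  moreover have "b * c \<in> K" using assms c subfield_mult[OF K] by simp
  ultimately have "1 = c \<and> a = b * c"
    using indep_cancel[OF assms(1) subfield_1[OF K] assms(2) c(1)] by simp
  then show ?thesis by simp
qed

lemma slope_neq:
  assumes "indep K u v" "a \<in> K"
  shows "line K (u + v * a) \<noteq> line K v"
proof
  assume "line K (u + v * a) = line K v"
  then obtain c where c: "c \<in> K" "u + v * a = v * c"
    using line_self[of "u + v * a"] by (auto simp: line_def)
  then have "u * 1 + v * a = u * 0 + v * c" by simp
  then have "(1::'f) = 0"
    using indep_cancel[OF assms(1) subfield_1[OF K] assms(2) subfield_0[OF K] c(1)] by simp
  then show False by simp
qed

lemma baer_directions_subset: "indep K u v \<Longrightarrow> baer_directions u v \<subseteq> directions K"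
  unfolding baer_directions_def
  using directions_line slope_nonzero indep_nonzero in_K by blast

lemma card_baer_directions:
  assumes "indep K u v"
  shows "card (baer_directions u v) = r + 1"
proof -
  have "card ((\<lambda>a. line K (u + v * a)) ` k) = r"
    using slope_inj[OF assms] in_K card_k by (subst card_image) (auto intro: inj_onI)
  moreover have "line K v \<notin> (\<lambda>a. line K (u + v * a)) ` k" using slope_neq[OF assms] in_K by fastforce
  ultimately show ?thesis by (simp add: baer_directions_def)
qed

lemma baer_eq:
  assumes "indep K u v"
  shows "baer K k u v = \<Union>(baer_directions u v) - {0}"
proof (intro equalityI subsetI)
  fix z assume "z \<in> baer K k u v"
  then obtain c a b where c: "c \<in> K" "c \<noteq> 0" "a \<in> k" "b \<in> k" "a \<noteq> 0 \<or> b \<noteq> 0"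
    "z = c * (u * a + v * b)" by (auto simp: baer_def)
  have z: "z \<noteq> 0" using c indepD[OF assms, of a b] in_K by auto
  show "z \<in> \<Union>(baer_directions u v) - {0}"
  proof (cases "a = 0")
    case True
    then have "z = v * (c * b)" using c by simp
    then have "z \<in> line K v" using mult_in_line[of "c * b" v] c in_K subfield_mult[OF K] by blast
    then show ?thesis using z by (auto simp: baer_directions_def)
  next
    case False
    have "z = (u + v * (b / a)) * (c * a)" using c False by (simp add: field_simps)
    then have "z \<in> line K (u + v * (b / a))"
      using mult_in_line[of "c * a"] c in_K subfield_mult[OF K] by blast
    moreover have "b / a \<in> k" using c subfield_divide[OF k] by simp
    ultimately show ?thesis using z unfolding baer_directions_def by blast
  qed
next
  fix z assume z: "z \<in> \<Union>(baer_directions u v) - {0}"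
  then consider c where "c \<in> K" "z = v * c" | a c where "a \<in> k" "c \<in> K" "z = (u + v * a) * c"
    by (auto simp: baer_directions_def line_def)
  then show "z \<in> baer K k u v"
  proof cases
    case (1 c)
    then have "z = c * (u * 0 + v * 1)" "c \<noteq> 0" using z by auto
    then show ?thesis using baerI[of c K 0 k 1 u v] 1 subfield_0[OF k] subfield_1[OF k]
        by (simp add: mult.commute)
  next
    case (2 a c)
    then have "z = c * (u * 1 + v * a)" "c \<noteq> 0" using z by auto
    then show ?thesis using baerI[of c K 1 k a u v] 2 subfield_1[OF k]
        by (simp add: mult.commute)
  qed
qed

lemma baer_peisert: "indep K u v \<Longrightarrow> peisert_type K (r + 1) (baer K k u v)"
  using peisert_type_Union[of "baer_directions u v"] baer_directions_subset card_baer_directions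
    baer_eq r_less_q by simp

lemma directions_in_baer: "indep K u v \<Longrightarrow> directions_in K (baer K k u v) = baer_directions u v"
  using directions_in_Union baer_directions_subset baer_eq by simp

text \<open>Rescaling two of the spanning vectors gives the three directions the slopes 0, infinity
  and 1.\<close>

lemma adapted_basis:
  assumes "D \<subseteq> directions K" "L1 \<in> D" "L2 \<in> D" "L3 \<in> D" "L1 \<noteq> L2" "L1 \<noteq> L3" "L2 \<noteq> L3"
  obtains u v where "indep K u v" "line K u = L1" "line K v = L2" "line K (u + v) = L3"
proof -
  obtain c1 c2 c3 where c: "c1 \<noteq> 0" "L1 = line K c1" "c2 \<noteq> 0" "L2 = line K c2" "c3 \<noteq> 0" "L3 = line K c3"
    using subsetD[OF assms(1)] assms(2-4) directionsE[of L1] directionsE[of L2] directionsE[of L3] by metis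
  then have "indep K c1 c2" using indep_lines assms by simp
  then obtain a b where ab: "a \<in> K" "b \<in> K" "c3 = c1 * a + c2 * b" using indep_coords by metis
  have "a \<noteq> 0" using c assms ab line_eqI[of c3 c2] mult_in_line[of b c2] by auto
  then have u: "line K (c1 * a) = L1" using c line_eqI[of "c1 * a" c1] mult_in_line ab by auto
  have "b \<noteq> 0" using c assms ab line_eqI[of c3 c1] mult_in_line[of a c1] by auto
  then have v: "line K (c2 * b) = L2" using c line_eqI[of "c2 * b" c2] mult_in_line ab by auto
  have "indep K (c1 * a) (c2 * b)"
    using indep_lines u v assms c \<open>a \<noteq> 0\<close> \<open>b \<noteq> 0\<close> by simp
  then show ?thesis using that u v ab c by blast
qed

lemma noncanonical_imp_baer:
  assumes S: "peisert_type K m S" "m \<le> r + 1"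
    and C: "maximum_clique (Cay S) C" "\<not> canonical_clique K S C"
  shows "m = r + 1 \<and> (\<exists>u v. indep K u v \<and> S = baer K k u v)"
proof -
  let ?D = "directions_in K S"
  have C': "clique (Cay S) C" "card C = r ^ 2" using C maximum_clique_iff[OF S(1)] by auto
  then obtain p0 where p0: "p0 \<in> C" using r_ge_2 by fastforce
  \<comment> \<open>A translate through 0, so that lines through 0 in \<open>S\<close>-directions
    meet it in \<open>r\<close> points.\<close>
  define U where "U = (+) (- p0) ` C"
  have CU: "C = (+) p0 ` U" by (simp add: U_def image_image)
  have U0: "0 \<in> U" unfolding U_def using p0 by force
  have cU: "card U = r ^ 2" using C' by (simp add: U_def card_image)
  have clique: "u - w \<in> S" if "u \<in> U" "w \<in> U" "u \<noteq> w" for u w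
    using that C'(1) by (auto simp: U_def clique_Cay)
  have not_line: "U \<noteq> (+) x ` L" if "L \<in> ?D" for L x
  proof
    assume "U = (+) x ` L"
    then have "C = (+) (p0 + x) ` L" using CU by (simp add: image_image add.assoc)
    then show False using C(2) that canonical_clique_iff by blast
  qed
  note meets = noncanonical_line_meets[OF S cU clique not_line]
  have m: "m = r + 1" by (rule meets(1))
  have rich: "card {z \<in> U. z - p \<in> L} = r" if "L \<in> ?D" "p \<in> U" for L p
    using meets(2) that by blast
  have unique: "L = M" if "R \<notin> U" "L \<in> ?D" "M \<in> ?D" "x \<in> U" "x - R \<in> L" "y \<in> U" "y - R \<in> M" for R L M x y
    using meets(3) that by blast
  have cD: "card ?D = r + 1" using peisert_typeD(2)[OF S(1)] m by simp
  then obtain T where "T \<subseteq> ?D" "card T = 3"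
    using r_ge_2 obtain_subset_with_card_n[of 3 ?D] by auto
  then obtain L1 L2 L3 where L: "L1 \<in> ?D" "L2 \<in> ?D" "L3 \<in> ?D" "L1 \<noteq> L2" "L1 \<noteq> L3" "L2 \<noteq> L3"
    by (auto simp: card_3_iff)
  obtain u v where uv: "indep K u v" "line K u = L1" "line K v = L2" "line K (u + v) = L3"
    using adapted_basis[OF directions_in_subset L] .
  have un: "u \<noteq> 0" "v \<noteq> 0" using indep_nonzero[OF uv(1)] by auto
  define A where "A = {x \<in> K. u * x \<in> U}"
  define B where "B = {y \<in> K. v * y \<in> U}"
  have "(*) u ` A = {z \<in> U. z - 0 \<in> L1}" by (auto simp: A_def uv(2)[symmetric] line_def)
  then have cA: "card A = r" using rich[OF L(1) U0] card_image[of "(*) u" A] un by (auto simp: inj_on_def)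
  have "(*) v ` B = {z \<in> U. z - 0 \<in> L2}" by (auto simp: B_def uv(3)[symmetric] line_def)
  then have cB: "card B = r" using rich[OF L(2) U0] card_image[of "(*) v" B] un by (auto simp: inj_on_def)
  \<comment> \<open>If the point were off \<open>U\<close>, the lines through it parallel to the two
    axes would both meet \<open>U\<close>, at \<open>v * y\<close> and \<open>u * x\<close>,
    contrary to \<open>unique\<close>.\<close>
  have prod: "u * x + v * y \<in> U" if "x \<in> A" "y \<in> B" for x y
  proof (rule ccontr)
    let ?R = "u * x + v * y"
    assume R: "?R \<notin> U"
    have "u * x - ?R \<in> L2" "v * y - ?R \<in> L1"
      using that mult_in_line[of "- y" v] mult_in_line[of "- x" u] subfield_uminus[OF K] uv
      by (auto simp: A_def B_def)
    moreover have "u * x \<in> U" "v * y \<in> U" using that by (auto simp: A_def B_def)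
    ultimately show False using unique[OF R L(2) L(1)] L(4) by blast
  qed
  have "inj_on (\<lambda>(x, y). u * x + v * y) (A \<times> B)"
    using indep_cancel[OF uv(1)] by (auto intro!: inj_onI simp: A_def B_def)
  then have "(\<lambda>(x, y). u * x + v * y) ` (A \<times> B) = U"
    using prod by (intro card_subset_eq)
      (auto simp: card_image card_cartesian_product cA cB cU power2_eq_square)
  then have U_ex: "\<exists>x\<in>A. \<exists>y\<in>B. z = u * x + v * y" if "z \<in> U" for z using that by auto
  have U_iff: "u * x + v * y \<in> U \<longleftrightarrow> x \<in> A \<and> y \<in> B" if xy: "x \<in> K" "y \<in> K" for x y
  proof
    assume "u * x + v * y \<in> U"
    then obtain x' y' where "x' \<in> A" "y' \<in> B" "u * x + v * y = u * x' + v * y'" using U_ex by blast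
    then show "x \<in> A \<and> y \<in> B" using indep_cancel[OF uv(1) xy, of x' y'] by (auto simp: A_def B_def)
  qed (use prod in blast)
  have AK: "x \<in> K" if "x \<in> A" for x using that by (simp add: A_def)
  \<comment> \<open>On the diagonal both coordinates agree, so its \<open>r\<close> points of
    \<open>U\<close> come from \<open>A \<inter> B\<close>; as \<open>A\<close> and \<open>B\<close>
    have only \<open>r\<close> elements, they coincide.\<close>
  have "{z \<in> U. z - 0 \<in> L3} = (*) (u + v) ` (A \<inter> B)"
    using U_iff by (auto simp: uv(4)[symmetric] line_def A_def B_def distrib_right)
  then have "card ((*) (u + v) ` (A \<inter> B)) = r" using rich[OF L(3) U0] by simp
  then have cAB: "r \<le> card (A \<inter> B)" by (metis card_image_le finite)
  have "A \<inter> B = A" by (rule card_seteq) (use cAB cA in auto)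
  moreover have "A \<inter> B = B" by (rule card_seteq) (use cAB cB in auto)
  ultimately have AB: "B = A" by simp
  \<comment> \<open>Used twice below: if the \<open>r\<close> points on a line are parametrised by a
    subset of \<open>A\<close>, that subset is all of \<open>A\<close>.\<close>
  have full: "T = A" if "card X = r" "X = f ` T" "T \<subseteq> A" for X :: "'f set" and f T
    by (rule card_seteq) (use that cA card_image_le[of T f] in auto)
  have A0: "0 \<in> A" using U0 subfield_0[OF K] by (simp add: A_def)
  \<comment> \<open>The line of slope 1 through \<open>u * x\<close> meets \<open>U\<close> at the
    parameters \<open>t\<close> for which \<open>t\<close> and \<open>x + t\<close> are both in
    \<open>A\<close>.\<close>
  have add: "x + t \<in> A" if x: "x \<in> A" and t: "t \<in> A" for x t
  proof -
    let ?T = "{t \<in> A. x + t \<in> A}"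
    have c: "card {z \<in> U. z - u * x \<in> L3} = r"
      using x by (intro rich[OF L(3)]) (simp add: A_def)
    have e: "{z \<in> U. z - u * x \<in> L3} = (\<lambda>t. u * (x + t) + v * t) ` ?T"
    proof (intro equalityI subsetI)
      fix z assume "z \<in> {z \<in> U. z - u * x \<in> L3}"
      then obtain t where t: "t \<in> K" "z \<in> U" "z - u * x = (u + v) * t"
        using uv(4) by (auto simp: line_def)
      then have "z = u * (x + t) + v * t" by (simp add: algebra_simps)
      then show "z \<in> (\<lambda>t. u * (x + t) + v * t) ` ?T"
        using U_iff[of "x + t" t] t AK[OF x] subfield_add[OF K] AB by auto
    next
      fix z assume "z \<in> (\<lambda>t. u * (x + t) + v * t) ` ?T"
      then obtain t where t: "t \<in> A" "x + t \<in> A" "z = u * (x + t) + v * t" by auto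
      then have "z - u * x = (u + v) * t" by (simp add: algebra_simps)
      then show "z \<in> {z \<in> U. z - u * x \<in> L3}"
        using t U_iff[of "x + t" t] AK AB mult_in_line[of t "u + v"] uv(4) by auto
    qed
    have "?T = A" by (rule full[OF c e]) auto
    then show ?thesis using t by auto
  qed
  define M where "M = {s \<in> K. line K (u + v * s) \<in> ?D}"
  \<comment> \<open>The line of slope \<open>s\<close> through 0 meets \<open>U\<close> at the
    parameters \<open>t\<close> for which \<open>t\<close> and \<open>s * t\<close> are both in
    \<open>A\<close>.\<close>
  have stable: "s * t \<in> A" if s: "s \<in> M" and t: "t \<in> A" for s t
  proof -
    let ?T = "{t \<in> A. s * t \<in> A}"
    have c: "card {z \<in> U. z - 0 \<in> line K (u + v * s)} = r"
      using s by (intro rich[OF _ U0]) (simp add: M_def)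
    have e: "{z \<in> U. z - 0 \<in> line K (u + v * s)} = (\<lambda>t. u * t + v * (s * t)) ` ?T"
    proof (intro equalityI subsetI)
      fix z assume "z \<in> {z \<in> U. z - 0 \<in> line K (u + v * s)}"
      then obtain t where t: "t \<in> K" "z \<in> U" "z = u * t + v * (s * t)"
        by (auto simp: line_def algebra_simps)
      then show "z \<in> (\<lambda>t. u * t + v * (s * t)) ` ?T"
        using U_iff[of t "s * t"] s subfield_mult[OF K] AB by (auto simp: M_def)
    next
      fix z assume "z \<in> (\<lambda>t. u * t + v * (s * t)) ` ?T"
      then obtain t where t: "t \<in> A" "s * t \<in> A" "z = u * t + v * (s * t)" by auto
      then have "z = (u + v * s) * t" by (simp add: algebra_simps)
      then show "z \<in> {z \<in> U. z - 0 \<in> line K (u + v * s)}"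
        using t U_iff[of t "s * t"] AK AB mult_in_line[of t "u + v * s"] by auto
    qed
    have "?T = A" by (rule full[OF c e]) auto
    then show ?thesis using t by auto
  qed
  have D_eq: "?D = insert (line K v) ((\<lambda>s. line K (u + v * s)) ` M)"
  proof (intro equalityI subsetI)
    fix N assume N: "N \<in> ?D"
    then obtain c where c: "c \<noteq> 0" "N = line K c" by (auto simp: directions_in_def directions_def)
    obtain x y where xy: "x \<in> K" "y \<in> K" "c = u * x + v * y" using indep_coords[OF uv(1)] .
    show "N \<in> insert (line K v) ((\<lambda>s. line K (u + v * s)) ` M)"
    proof (cases "x = 0")
      case True
      then show ?thesis using c xy line_eqI[of c v] mult_in_line[of y v] by auto
    next
      case False
      then have "c = (u + v * (y / x)) * x" using xy by (simp add: field_simps)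
      then have N': "N = line K (u + v * (y / x))"
        using c line_eqI mult_in_line[OF xy(1)] by metis
      then have "y / x \<in> M" unfolding M_def using N xy subfield_divide[OF K] by blast
      then show ?thesis using N' by blast
    qed
  qed (use L uv in \<open>auto simp: M_def\<close>)
  have cM: "card M = r"
  proof -
    have "inj_on (\<lambda>s. line K (u + v * s)) M"
      using slope_inj[OF uv(1)] by (auto intro: inj_onI simp: M_def)
    moreover have "line K v \<notin> (\<lambda>s. line K (u + v * s)) ` M"
      using slope_neq[OF uv(1)] by (fastforce simp: M_def)
    ultimately show ?thesis using cD by (simp add: D_eq card_image)
  qed
  have "\<not> A \<subseteq> {0}" using card_mono[of "{0}" A] cA r_ge_2 by auto
  then obtain a0 where a0: "a0 \<in> A" "a0 \<noteq> 0" by blast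
  \<comment> \<open>Stability gives one inclusion and both sets have \<open>r\<close> elements. Thus
    \<open>M\<close> inherits sums from \<open>A\<close>, and stability of \<open>A\<close> under
    \<open>M\<close> gives products.\<close>
  have M_eq: "M = (\<lambda>x. x / a0) ` A"
  proof (rule card_seteq)
    show "M \<subseteq> (\<lambda>x. x / a0) ` A"
    proof
      fix s assume "s \<in> M"
      then have "s * a0 \<in> A" "s = s * a0 / a0" using stable a0 by auto
      then show "s \<in> (\<lambda>x. x / a0) ` A" by blast
    qed
    show "card ((\<lambda>x. x / a0) ` A) \<le> card M" using card_image_le[of A] cA cM by simp
  qed simp
  have "is_subfield M"
  proof (rule is_subfieldI_closed)
    show "1 \<in> M" using a0 by (force simp: M_eq)
    fix x y assume xy: "x \<in> M" "y \<in> M"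
    then obtain x' y' where "x' \<in> A" "y' \<in> A" "x = x' / a0" "y = y' / a0" by (auto simp: M_eq)
    then have "x + y = (x' + y') / a0" "x' + y' \<in> A" using add by (auto simp: add_divide_distrib)
    then show "x + y \<in> M" unfolding M_eq by blast
    have "x * (y * a0) \<in> A" "x * y = x * (y * a0) / a0" using stable xy a0 by auto
    then show "x * y \<in> M" unfolding M_eq by blast
  qed
  then have "M = k" using subfield_eq_fixed_points[of M] cM k_iff by auto
  then have "?D = baer_directions u v" using D_eq by (simp add: baer_directions_def)
  then have "S = baer K k u v" using peisert_typeD(1)[OF S(1)] baer_eq[OF uv(1)] by simp
  then show ?thesis using m uv(1) by blast
qed

end

section \<open>Extremal graphs\<close>

lemma six_times_choose_3: "6 * (Suc n choose 3) = Suc n * n * (n - 1)"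
proof -
  have "(Suc n choose 3) * 3 = Suc n * (n choose 2)"
    using Suc_times_binomial_eq[of n 2] by (simp add: numeral_3_eq_3 numeral_2_eq_2)
  moreover have "2 * (n choose 2) = n * (n - 1)"
    unfolding choose_two by (rule dvd_mult_div_cancel) (cases n, simp_all)
  moreover have "6 * (Suc n choose 3) = 2 * ((Suc n choose 3) * 3)" by (rule trans[OF _ mult.commute]) simp
  moreover have "2 * (Suc n * (n choose 2)) = Suc n * (2 * (n choose 2))" by (rule mult.left_commute)
  ultimately show ?thesis by (simp only: mult.assoc)
qed

lemma inj_Cay: "inj Cay"
proof (rule injI)
  fix S T :: "'a set" assume "Cay S = Cay T"
  then have "adj (Cay S) s 0 = adj (Cay T) s 0" for s by simp
  then show "S = T" by (auto simp: Cay_def)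
qed

context field_tower
begin

text \<open>The \<open>k\<close>-span of \<open>u\<close> and \<open>v\<close> is such a clique: no
  line contains 0, \<open>u\<close> and \<open>v\<close>. Excluding lines in all directions keeps it
  non-canonical in every larger connection set.\<close>

lemma baer_has_nonline_clique:
  assumes "indep K u v"
  shows "\<exists>C. clique (Cay (baer K k u v)) C \<and> card C = r ^ 2 \<and>
    (\<forall>L\<in>directions K. \<forall>x. C \<noteq> (+) x ` L)"
proof (intro exI conjI ballI allI)
  let ?f = "\<lambda>(a, b). u * a + v * b"
  let ?C = "?f ` (k \<times> k)"
  show "clique (Cay (baer K k u v)) ?C"
    unfolding clique_Cay
  proof clarsimp
    fix a b c d assume *: "a \<in> k" "b \<in> k" "c \<in> k" "d \<in> k" "u * a + v * b \<noteq> u * c + v * d"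
    then have "1 * (u * (a - c) + v * (b - d)) \<in> baer K k u v"
      using subfield_diff[OF k] subfield_1[OF K] by (intro baerI) auto
    then show "u * a + v * b - (u * c + v * d) \<in> baer K k u v" by (simp add: algebra_simps)
  qed
  have "inj_on ?f (k \<times> k)"
    using k_subset_K by (intro inj_on_subset[OF bij_betw_imp_inj_on[OF indep_bij[OF assms]]]) auto
  then show "card ?C = r ^ 2"
    by (simp add: card_image card_cartesian_product card_k power2_eq_square)
  show "?C \<noteq> (+) x ` L" if L: "L \<in> directions K" for L x
  proof
    assume eq: "?C = (+) x ` L"
    have "u * 0 + v * 0 \<in> ?C" "u * 1 + v * 0 \<in> ?C" "u * 0 + v * 1 \<in> ?C"
      using subfield_0[OF k] subfield_1[OF k] by force+
    then have "0 \<in> (+) x ` L" "u \<in> (+) x ` L" "v \<in> (+) x ` L" using eq by auto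
    then have m: "- x \<in> L" "u - x \<in> L" "v - x \<in> L" by (auto simp: minus_unique)
    then have "u \<in> L" "v \<in> L" using directions_diff[OF L, of "u - x" "-x"] directions_diff[OF L, of "v - x" "-x"] by auto
    then have "line K u = line K v" using directions_eq[OF L] indep_nonzero[OF assms] by blast
    then have "u \<in> line K v" using line_self by blast
    then obtain a where "a \<in> K" "u = v * a" by (auto simp: line_def)
    then have "u * (- 1) + v * a = 0" by simp
    then show False
      using indepD[OF assms, of "- 1" a] \<open>a \<in> K\<close> subfield_1[OF K] subfield_uminus[OF K] by auto
  qed
qed

lemma baer_subset_not_strict_EKR:
  assumes "indep K u v" "peisert_type K m T" "baer K k u v \<subseteq> T"
  shows "\<not> strict_EKR K T"
proof -
  obtain C where C: "clique (Cay (baer K k u v)) C" "card C = r ^ 2"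
    "\<forall>L\<in>directions K. \<forall>x. C \<noteq> (+) x ` L"
    using baer_has_nonline_clique[OF assms(1)] by blast
  have "clique (Cay T) C" using C(1) assms(3) unfolding clique_Cay by blast
  then have "maximum_clique (Cay T) C" using maximum_clique_iff[OF assms(2)] C(2) by simp
  moreover have "\<not> canonical_clique K T C"
    using C(3) directions_in_subset[of T] by (auto simp: canonical_clique_iff)
  ultimately show ?thesis by (auto simp: strict_EKR_def)
qed

text \<open>A graph with a non-canonical maximum clique and \<open>m \<le> r + 1\<close> is a Baer
  subline with \<open>m = r + 1\<close>; for \<open>m > r + 1\<close> extremality fails because type
  \<open>m - 1\<close> already has such cliques.\<close>

lemma extremal_iff: "extremal K S \<longleftrightarrow> (\<exists>u v. indep K u v \<and> S = baer K k u v)"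
proof
  assume "extremal K S"
  then obtain m where S: "peisert_type K m S" "\<not> strict_EKR K S"
    and strict: "\<And>T. peisert_type K (m - 1) T \<Longrightarrow> strict_EKR K T"
    by (auto simp: extremal_def extremal_of_type_def)
  have "m \<le> r + 1"
  proof (rule ccontr)
    assume m: "\<not> m \<le> r + 1"
    obtain u v where uv: "indep K u v" by (rule exists_indep)
    \<comment> \<open>There is room for a Baer subline inside a set of
      \<open>m - 1 \<ge> r + 1\<close> directions.\<close>
    have "\<exists>D. baer_directions u v \<subseteq> D \<and> D \<subseteq> directions K \<and> card D = m - 1"
      using m peisert_typeD(4)[OF S(1)] card_baer_directions[OF uv] baer_directions_subset[OF uv]
      by (intro exists_subset_between) (auto simp: card_directions)
    then obtain D where D: "baer_directions u v \<subseteq> D" "D \<subseteq> directions K" "card D = m - 1" by blast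
    have "peisert_type K (m - 1) (\<Union>D - {0})"
      using peisert_type_Union[OF D(2)] D(3) m peisert_typeD(4)[OF S(1)] by simp
    moreover have "baer K k u v \<subseteq> \<Union>D - {0}" using baer_eq[OF uv] D(1) by auto
    ultimately show False using strict baer_subset_not_strict_EKR[OF uv] by blast
  qed
  then show "\<exists>u v. indep K u v \<and> S = baer K k u v"
    using noncanonical_imp_baer[OF S(1)] S(2) by (auto simp: strict_EKR_def)
next
  assume "\<exists>u v. indep K u v \<and> S = baer K k u v"
  then obtain u v where uv: "indep K u v" "S = baer K k u v" by blast
  have "strict_EKR K T" if "peisert_type K r T" for T
    using noncanonical_imp_baer[OF that] by (auto simp: strict_EKR_def)
  then have "extremal_of_type K (r + 1) S"
    using baer_peisert[OF uv(1)] baer_subset_not_strict_EKR[OF uv(1)] uv(2)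
    by (auto simp: extremal_of_type_def)
  then show "extremal K S" unfolding extremal_def by blast
qed

text \<open>A Baer subline is determined by the three points spanned by \<open>u\<close>,
  \<open>v\<close> and \<open>u + v\<close>. Only one inclusion is derived; equal cardinality gives
  the other.\<close>

lemma baer_eqI:
  assumes "indep K u' v'" "indep K u v"
    and "u \<in> baer K k u' v'" "v \<in> baer K k u' v'" "u + v \<in> baer K k u' v'"
  shows "baer K k u v = baer K k u' v'"
proof -
  obtain x1 a1 b1 where 1: "x1 \<in> K" "x1 \<noteq> 0" "a1 \<in> k" "b1 \<in> k" "u = x1 * (u' * a1 + v' * b1)"
    using assms(3) by (auto simp: baer_def)
  obtain x2 a2 b2 where 2: "x2 \<in> K" "x2 \<noteq> 0" "a2 \<in> k" "b2 \<in> k" "v = x2 * (u' * a2 + v' * b2)"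
    using assms(4) by (auto simp: baer_def)
  obtain x3 a3 b3 where 3: "x3 \<in> K" "x3 \<noteq> 0" "a3 \<in> k" "b3 \<in> k" "u + v = x3 * (u' * a3 + v' * b3)"
    using assms(5) by (auto simp: baer_def)
  have in_K': "x1 * a1 + x2 * a2 \<in> K" "x1 * b1 + x2 * b2 \<in> K" "x3 * a3 \<in> K" "x3 * b3 \<in> K"
    using 1 2 3 in_K subfield_closed[OF K] by auto
  have "u' * (x1 * a1 + x2 * a2) + v' * (x1 * b1 + x2 * b2) = u' * (x3 * a3) + v' * (x3 * b3)"
    using 1(5) 2(5) 3(5) by (simp add: algebra_simps)
  then have e: "x1 * a1 + x2 * a2 = x3 * a3" "x1 * b1 + x2 * b2 = x3 * b3"
    using indep_cancel[OF assms(1) in_K'(1,2,3,4)] by auto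
  \<comment> \<open>By Cramer's rule \<open>x1\<close> and \<open>x2\<close> are \<open>k\<close>-multiples of \<open>x3\<close>, so \<open>u\<close> and \<open>v\<close> lie in the \<open>x3\<close>-multiple
    of the \<open>k\<close>-span of \<open>u'\<close> and \<open>v'\<close>.\<close>
  define d where "d = a1 * b2 - a2 * b1"
  have d: "d \<in> k" using 1 2 subfield_closed[OF k] by (simp add: d_def)
  \<comment> \<open>If \<open>d = 0\<close>, eliminating \<open>u'\<close> and then
    \<open>v'\<close> gives two linear relations between \<open>u\<close> and \<open>v\<close>;
    independence then makes \<open>a2\<close> and \<open>b2\<close> vanish, so
    \<open>v = 0\<close>.\<close>
  have "d \<noteq> 0"
  proof
    assume "d = 0"
    then have ab: "a1 * b2 = a2 * b1" by (simp add: d_def)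
    have "u * (x2 * a2) + v * (- (x1 * a1)) = x1 * x2 * v' * (a2 * b1 - a1 * b2)"
      "u * (x2 * b2) + v * (- (x1 * b1)) = x1 * x2 * u' * (a1 * b2 - a2 * b1)"
      unfolding 1(5) 2(5) by (auto simp: algebra_simps)
    then have "u * (x2 * a2) + v * (- (x1 * a1)) = 0" "u * (x2 * b2) + v * (- (x1 * b1)) = 0"
      using ab by auto
    moreover have "x2 * a2 \<in> K" "- (x1 * a1) \<in> K" "x2 * b2 \<in> K" "- (x1 * b1) \<in> K"
      using 1 2 in_K subfield_closed[OF K] by auto
    ultimately have "x2 * a2 = 0" "x2 * b2 = 0"
      using indepD[OF assms(2)] by blast+
    then have "v = 0" using 2 by auto
    then show False using indep_nonzero[OF assms(2)] by simp
  qed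
  have "x1 * d = (x1 * a1 + x2 * a2) * b2 - (x1 * b1 + x2 * b2) * a2"
    "x2 * d = (x1 * b1 + x2 * b2) * a1 - (x1 * a1 + x2 * a2) * b1"
    by (auto simp: d_def algebra_simps)
  then have x: "x1 = x3 * ((a3 * b2 - b3 * a2) / d)" "x2 = x3 * ((b3 * a1 - a3 * b1) / d)"
    using \<open>d \<noteq> 0\<close> unfolding e by (auto simp: field_simps)
  define s t where "s = (a3 * b2 - b3 * a2) / d" and "t = (b3 * a1 - a3 * b1) / d"
  have st: "s \<in> k" "t \<in> k" using 1 2 3 d subfield_closed[OF k] by (auto simp: s_def t_def)
  have uv: "u = x3 * (u' * (s * a1) + v' * (s * b1))" "v = x3 * (u' * (t * a2) + v' * (t * b2))"
    unfolding 1(5) 2(5) x(1)[folded s_def] x(2)[folded t_def] by (auto simp: algebra_simps)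
  have "baer K k u v \<subseteq> baer K k u' v'"
  proof
    fix z assume "z \<in> baer K k u v"
    then obtain c a b where c: "c \<in> K" "c \<noteq> 0" "a \<in> k" "b \<in> k" "a \<noteq> 0 \<or> b \<noteq> 0"
      "z = c * (u * a + v * b)" by (auto simp: baer_def)
    let ?a = "s * a1 * a + t * a2 * b" and ?b = "s * b1 * a + t * b2 * b"
    have z: "z = (c * x3) * (u' * ?a + v' * ?b)"
      unfolding c(6) by (subst uv(1), subst uv(2)) (simp add: algebra_simps)
    have "z \<noteq> 0" using indepD[OF assms(2), of a b] c in_K by auto
    then have "?a \<noteq> 0 \<or> ?b \<noteq> 0" using z by auto
    moreover have "?a \<in> k" "?b \<in> k" "c * x3 \<in> K" "c * x3 \<noteq> 0"
      using c 1 2 3 st subfield_add[OF k] subfield_mult[OF k] subfield_mult[OF K] by simp_all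
    ultimately show "z \<in> baer K k u' v'" using baerI[of "c * x3" K ?a k ?b u' v'] z by simp
  qed
  then show ?thesis
    by (rule card_subset_eq[rotated])
      (use card_peisert[OF baer_peisert[OF assms(1)]] card_peisert[OF baer_peisert[OF assms(2)]] in auto)
qed

section \<open>Uniqueness through three directions and the number of extremal sets\<close>

lemma extremal_type: "extremal K S \<Longrightarrow> peisert_type K (r + 1) S"
  using baer_peisert by (auto simp: extremal_iff)

lemma three_directions_unique_extremal:
  assumes "D \<subseteq> directions K" "card D = 3"
  shows "\<exists>!T. extremal K T \<and> D \<subseteq> directions_in K T"
proof -
  obtain L1 L2 L3 where L: "D = {L1, L2, L3}" "L1 \<noteq> L2" "L1 \<noteq> L3" "L2 \<noteq> L3"
    using assms(2) by (auto simp: card_3_iff)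
  then obtain u v where uv: "indep K u v" "line K u = L1" "line K v = L2" "line K (u + v) = L3"
    using adapted_basis[OF assms(1), of L1 L2 L3] by auto
  have "L1 = line K (u + v * 0)" "L3 = line K (u + v * 1)" using uv by auto
  then have D: "D \<subseteq> directions_in K (baer K k u v)"
    using L(1) uv subfield_0[OF k] subfield_1[OF k]
    unfolding directions_in_baer[OF uv(1)] baer_directions_def by blast
  show ?thesis
  proof (rule ex1I[of _ "baer K k u v"])
    show "extremal K (baer K k u v) \<and> D \<subseteq> directions_in K (baer K k u v)"
      using D extremal_iff uv(1) by blast
    fix T assume T: "extremal K T \<and> D \<subseteq> directions_in K T"
    then obtain u' v' where u': "indep K u' v'" "T = baer K k u' v'" using extremal_iff by blast
    have "u \<noteq> 0" "v \<noteq> 0" "u + v \<noteq> 0"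
      using indep_nonzero[OF uv(1)] slope_nonzero[OF uv(1), of 1] subfield_1[OF K] by auto
    then have "u \<in> T" "v \<in> T" "u + v \<in> T"
      using in_peisert_iff[OF extremal_type, of T] T uv L(1) by auto
    then show "T = baer K k u v" using baer_eqI[OF u'(1) uv(1)] u'(2) by simp
  qed
qed

lemma subset_iff_directions:
  assumes "peisert_type K m S"
  shows "S \<subseteq> T \<longleftrightarrow> directions_in K S \<subseteq> directions_in K T"
proof
  assume sub: "directions_in K S \<subseteq> directions_in K T"
  have "\<Union>(directions_in K T) - {0} \<subseteq> T" by (auto simp: directions_in_def)
  then show "S \<subseteq> T" using sub peisert_typeD(1)[OF assms] by blast
qed (rule directions_in_mono)

lemma type_3_unique_extremal:
  "peisert_type K 3 S \<Longrightarrow> \<exists>!T. extremal K T \<and> S \<subseteq> T"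
  using three_directions_unique_extremal[OF directions_in_subset, of S] peisert_typeD(2)[of 3 S]
    subset_iff_directions[of 3 S] by simp

text \<open>The 3-sets of directions are partitioned among the extremal sets, so the number is the
  quotient of \<open>Suc (r ^ 2) choose 3\<close> by \<open>Suc r choose 3\<close>; the factor 6
  avoids division.\<close>

lemma card_extremal: "card {S. extremal K S} = (r ^ 2 + 1) * r"
proof -
  let ?E = "{S. extremal K S}"
  let ?t = "\<lambda>A::'f set set. {D. D \<subseteq> A \<and> card D = 3}"
  have cover: "?t (directions K) = (\<Union>S\<in>?E. ?t (directions_in K S))"
  proof (intro equalityI subsetI)
    fix D assume "D \<in> ?t (directions K)"
    then show "D \<in> (\<Union>S\<in>?E. ?t (directions_in K S))"
      using three_directions_unique_extremal[of D] by auto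
  next
    fix D assume "D \<in> (\<Union>S\<in>?E. ?t (directions_in K S))"
    then show "D \<in> ?t (directions K)" by (auto simp: directions_in_def)
  qed
  have disj: "S = T" if "S \<in> ?E" "T \<in> ?E" "D \<in> ?t (directions_in K S)" "D \<in> ?t (directions_in K T)" for S T D
    using three_directions_unique_extremal[of D] directions_in_subset[of S] that by blast
  have "card (?t (directions K)) = (\<Sum>S\<in>?E. card (?t (directions_in K S)))"
    unfolding cover
  proof (rule card_UN_disjoint)
    show "\<forall>S\<in>?E. \<forall>T\<in>?E. S \<noteq> T \<longrightarrow> ?t (directions_in K S) \<inter> ?t (directions_in K T) = {}"
      using disj by blast
  qed auto
  also have "\<dots> = (\<Sum>S\<in>?E. (r + 1) choose 3)"
  proof (rule sum.cong)
    fix S assume "S \<in> ?E"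
    then show "card (?t (directions_in K S)) = (r + 1) choose 3"
      using n_subsets[of "directions_in K S" 3] peisert_typeD(2)[OF extremal_type] by simp
  qed simp
  finally have "(Suc (r ^ 2) choose 3) = card ?E * (Suc r choose 3)"
    using n_subsets[of "directions K" 3] by (simp add: card_directions)
  then have "Suc (r ^ 2) * r ^ 2 * (r ^ 2 - 1) = card ?E * (Suc r * r * (r - 1))"
    using six_times_choose_3[of "r ^ 2"] six_times_choose_3[of r] by (metis mult.left_commute)
  moreover have "Suc r * r * (r - 1) = r * (r ^ 2 - 1)"
    unfolding r_sq[symmetric] by (simp only: Suc_eq_plus1 ac_simps)
  moreover have "Suc (r ^ 2) * r ^ 2 * w = ((r ^ 2 + 1) * r) * (r * w)" for w
    by (simp add: power2_eq_square algebra_simps)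
  ultimately have "card ?E * (r * (r ^ 2 - 1)) = ((r ^ 2 + 1) * r) * (r * (r ^ 2 - 1))"
    by (simp only:)
  then show ?thesis
    by (rule mult_right_cancel[THEN iffD1, rotated]) (use r_less_q r_ge_2 in auto)
qed

lemma card_Cay_extremal: "card (Cay ` {S. extremal K S}) = (r ^ 2 + 1) * r"
  using card_extremal inj_Cay by (subst card_image) (auto intro: inj_on_subset)

end

section \<open>Norm coordinates and cliques\<close>

text \<open>\<open>x ^ (r + 1)\<close> is the norm from \<open>K\<close> to \<open>k\<close>. In
  these coordinates adjacency depends only on the norms of the two coordinate differences, and the
  axes are directions outside \<open>S\<close>.\<close>

locale norm_coords = field_tower +
  fixes u v :: 'a and S :: "'a set"
  assumes indep: "indep K u v"
    and S_iff: "\<And>x y. x \<in> K \<Longrightarrow> y \<in> K \<Longrightarrow>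
      u * x + v * y \<in> S \<longleftrightarrow> (x \<noteq> 0 \<or> y \<noteq> 0) \<and> x ^ (r + 1) = y ^ (r + 1)"
    and peisert: "peisert_type K (r + 1) S"

context field_tower
begin

lemma exists_K_not_k: "\<exists>w\<in>K. w \<notin> k"
proof -
  have "card k < card K" using r_less_q by (simp add: card_k card_K)
  then show ?thesis by (metis card_mono finite not_less subsetI)
qed

lemma baer_norm_coords:
  assumes "indep K u0 v0"
  shows "\<exists>u v. norm_coords K k r u v (baer K k u0 v0)"
proof -
  obtain w where w: "w \<in> K" "w \<notin> k" using exists_K_not_k by blast
  define d where "d = w - w ^ r"
  have d: "d \<noteq> 0" "d \<in> K" using w k_iff subfield_closed[OF K] by (auto simp: d_def)
  have dr: "d ^ r = - d" using w by (simp add: d_def frobenius_diff frobenius_frobenius)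
  \<comment> \<open>The new coordinates are \<open>X = x + w y\<close> and \<open>Y = x + w\<^sup>r y\<close>, for which
    \<open>X\<^sup>r\<^sup>+\<^sup>1 - Y\<^sup>r\<^sup>+\<^sup>1 = (w - w\<^sup>r) (x\<^sup>r y - x y\<^sup>r)\<close>.\<close>
  define u v where "u = (v0 - w ^ r * u0) / d" and "v = (w * u0 - v0) / d"
  define x y where "x = (\<lambda>X Y. (w * Y - w ^ r * X) / d)" and "y = (\<lambda>X Y. (X - Y) / d)"
  have xy: "x X Y \<in> K" "y X Y \<in> K" if "X \<in> K" "Y \<in> K" for X Y
    using that w d subfield_closed[OF K] by (auto simp: x_def y_def)
  have eq: "u * X + v * Y = u0 * x X Y + v0 * y X Y" for X Y
    by (simp add: u_def v_def x_def y_def add_divide_distrib[symmetric] algebra_simps)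
  have zero: "x X Y = 0 \<and> y X Y = 0 \<longleftrightarrow> X = 0 \<and> Y = 0" for X Y
  proof
    assume "x X Y = 0 \<and> y X Y = 0"
    then have "X = Y" "w * Y = w ^ r * X" using d by (auto simp: x_def y_def)
    then have "d * X = 0" by (simp add: d_def algebra_simps)
    then show "X = 0 \<and> Y = 0" using d \<open>X = Y\<close> by simp
  qed (simp add: x_def y_def)
  have norm: "x X Y ^ r * y X Y = x X Y * y X Y ^ r \<longleftrightarrow> X ^ (r + 1) = Y ^ (r + 1)"
    if "X \<in> K" "Y \<in> K" for X Y
  proof -
    have e: "d * x X Y = w * Y - w ^ r * X" "d * y X Y = X - Y"
      using d by (simp_all add: x_def y_def)
    \<comment> \<open>Since \<open>d ^ r = - d\<close>, applying Frobenius to \<open>e\<close>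
      introduces a minus sign; this moves it to the other side.\<close>
    have neg: "a = c - b" if "- a = b - c" for a b c :: 'f
      using arg_cong[OF that, of uminus] by simp
    have "- (d * x X Y ^ r) = w ^ r * Y ^ r - w * X ^ r"
      using arg_cong[OF e(1), of "\<lambda>z. z ^ r"] w
      by (simp add: frobenius_diff power_mult_distrib frobenius_frobenius dr)
    moreover have "- (d * y X Y ^ r) = X ^ r - Y ^ r"
      using arg_cong[OF e(2), of "\<lambda>z. z ^ r"]
      by (simp add: frobenius_diff power_mult_distrib dr)
    ultimately have f: "d * x X Y ^ r = w * X ^ r - w ^ r * Y ^ r" "d * y X Y ^ r = Y ^ r - X ^ r"
      by (auto dest: neg)
    have "d * d * (x X Y ^ r * y X Y - x X Y * y X Y ^ r) =
      (d * x X Y ^ r) * (d * y X Y) - (d * x X Y) * (d * y X Y ^ r)"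
      by (simp add: algebra_simps)
    also have "\<dots> = (w * X ^ r - w ^ r * Y ^ r) * (X - Y) - (w * Y - w ^ r * X) * (Y ^ r - X ^ r)"
      unfolding e f ..
    also have "\<dots> = d * (X ^ (r + 1) - Y ^ (r + 1))" by (simp add: d_def algebra_simps)
    finally show ?thesis using d by auto
  qed
  have "norm_coords K k r u v (baer K k u0 v0)"
  proof
    show "indep K u v"
      unfolding indep_def eq
    proof (intro ballI impI)
      fix a b assume "a \<in> K" "b \<in> K" "u0 * x a b + v0 * y a b = 0"
      then show "a = 0 \<and> b = 0"
        using indepD[OF assms xy(1)[of a b] xy(2)[of a b]] zero[of a b] by simp
    qed
    show "peisert_type K (r + 1) (baer K k u0 v0)" by (rule baer_peisert[OF assms])
    fix X Y assume XY: "X \<in> K" "Y \<in> K"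
    show "u * X + v * Y \<in> baer K k u0 v0 \<longleftrightarrow> (X \<noteq> 0 \<or> Y \<noteq> 0) \<and> X ^ (r + 1) = Y ^ (r + 1)"
      unfolding eq baer_iff[OF assms xy[OF XY]] norm[OF XY] using zero[of X Y] by blast
  qed
  then show ?thesis by blast
qed

end

context norm_coords
begin

definition pt :: "'a \<Rightarrow> 'a \<Rightarrow> 'a" where "pt x y = u * x + v * y"

definition unit_norm :: "'a set" where "unit_norm = {t \<in> K. t ^ (r + 1) = 1}"

definition coords :: "'a \<Rightarrow> 'a \<times> 'a" where
  "coords = inv_into (K \<times> K) (\<lambda>(x, y). pt x y)"

definition lin_clique :: "'a \<Rightarrow> 'a set" where
  "lin_clique t = (\<lambda>x. pt x (t * x)) ` K"

definition frob_clique :: "'a \<Rightarrow> 'a set" where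
  "frob_clique t = (\<lambda>x. pt x (t * x ^ r)) ` K"

text \<open>With \<open>f\<close> the identity it takes \<open>lin_clique 1\<close> to
  \<open>lin_clique t\<close>; with \<open>f\<close> the Frobenius map it takes it to
  \<open>frob_clique t\<close>.\<close>

definition twist :: "'a \<Rightarrow> ('a \<Rightarrow> 'a) \<Rightarrow> 'a \<Rightarrow> 'a" where
  "twist t f z = (case coords z of (x, y) \<Rightarrow> pt x (t * f y))"

lemma pt_S_iff: "x \<in> K \<Longrightarrow> y \<in> K \<Longrightarrow> pt x y \<in> S \<longleftrightarrow> (x \<noteq> 0 \<or> y \<noteq> 0) \<and> x ^ (r + 1) = y ^ (r + 1)"
  unfolding pt_def by (rule S_iff)

lemma pt_diff: "pt x y - pt x' y' = pt (x - x') (y - y')"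
  by (simp add: pt_def algebra_simps)

lemma pt_eq_iff: "x \<in> K \<Longrightarrow> y \<in> K \<Longrightarrow> x' \<in> K \<Longrightarrow> y' \<in> K \<Longrightarrow> pt x y = pt x' y' \<longleftrightarrow> x = x' \<and> y = y'"
  using indep_cancel[OF indep, of x y x' y'] by (auto simp: pt_def)

lemma pt_0: "pt 0 0 = 0"
  by (simp add: pt_def)

lemma pt_cases: obtains x y where "x \<in> K" "y \<in> K" "z = pt x y"
  using indep_coords[OF indep] by (metis pt_def)

lemma coords_pt: "x \<in> K \<Longrightarrow> y \<in> K \<Longrightarrow> coords (pt x y) = (x, y)"
  unfolding coords_def pt_def
  using inv_into_f_f[OF bij_betw_imp_inj_on[OF indep_bij[OF indep]], of "(x, y)"] by simp

lemma twist_pt: "x \<in> K \<Longrightarrow> y \<in> K \<Longrightarrow> twist t f (pt x y) = pt x (t * f y)"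
  by (simp add: twist_def coords_pt)

lemma unit_normD: "t \<in> unit_norm \<Longrightarrow> t \<in> K \<and> t ^ (r + 1) = 1 \<and> t \<noteq> 0"
  by (auto simp: unit_norm_def)

lemma one_unit_norm: "1 \<in> unit_norm"
  using subfield_1[OF K] by (simp add: unit_norm_def)

lemma card_unit_norm: "card unit_norm = r + 1"
  unfolding unit_norm_def by (rule card_norm_1)

lemma norm_frobenius: "x \<in> K \<Longrightarrow> (x ^ r) ^ (r + 1) = x ^ (r + 1)"
  using frobenius_frobenius[of x] by (simp add: mult.commute)

definition norm_additive :: "('a \<Rightarrow> 'a) \<Rightarrow> bool" where
  "norm_additive f \<longleftrightarrow> (\<forall>x\<in>K. f x \<in> K \<and> f x ^ (r + 1) = x ^ (r + 1)) \<and>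
     (\<forall>x\<in>K. \<forall>y\<in>K. f (x - y) = f x - f y)"

lemma norm_additive_id: "norm_additive (\<lambda>x. x)"
  by (simp add: norm_additive_def)

lemma norm_additive_frobenius: "norm_additive (\<lambda>x. x ^ r)"
  unfolding norm_additive_def using norm_frobenius frobenius_diff subfield_power[OF K] by simp

text \<open>Additivity carries coordinate differences through the map, and \<open>t\<close> and
  \<open>f\<close> leave norms unchanged. Preserving norms also makes the kernel of \<open>f\<close>
  trivial, hence the map injective.\<close>

lemma twist_automorphism:
  assumes t: "t \<in> unit_norm" and f: "norm_additive f"
  shows "automorphism (Cay S) (twist t f)"
proof -
  have fK: "f y \<in> K" "f y ^ (r + 1) = y ^ (r + 1)" if "y \<in> K" for y
    using f that by (auto simp: norm_additive_def)
  have diff: "f (y - y') = f y - f y'" if "y \<in> K" "y' \<in> K" for y y'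
    using f that by (auto simp: norm_additive_def)
  have f_0: "f y = 0 \<longleftrightarrow> y = 0" if "y \<in> K" for y
    using fK(2)[OF that] by (metis power_eq_0_iff add_gr_0 zero_less_one)
  have tfK: "t * f y \<in> K" if "y \<in> K" for y
    using fK[OF that] unit_normD[OF t] subfield_mult[OF K] by simp
  have "inj (twist t f)"
  proof (rule injI)
    fix z z' assume eq: "twist t f z = twist t f z'"
    obtain x y where z: "x \<in> K" "y \<in> K" "z = pt x y" by (rule pt_cases)
    obtain x' y' where z': "x' \<in> K" "y' \<in> K" "z' = pt x' y'" by (rule pt_cases)
    have "pt x (t * f y) = pt x' (t * f y')" using eq z z' by (simp add: twist_pt)
    then have "x = x'" "t * f y = t * f y'" using pt_eq_iff tfK z z' by auto
    then have "f (y - y') = 0" using unit_normD[OF t] diff z z' by simp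
    then have "y = y'" using f_0 subfield_diff[OF K] z z' by auto
    then show "z = z'" using \<open>x = x'\<close> z z' by simp
  qed
  then have "bij (twist t f)" by (simp add: finite_UNIV_inj_surj bij_def)
  moreover have "z - z' \<in> S \<longleftrightarrow> twist t f z - twist t f z' \<in> S" for z z'
  proof -
    obtain x y where z: "x \<in> K" "y \<in> K" "z = pt x y" by (rule pt_cases)
    obtain x' y' where z': "x' \<in> K" "y' \<in> K" "z' = pt x' y'" by (rule pt_cases)
    have K': "x - x' \<in> K" "y - y' \<in> K" using z z' subfield_diff[OF K] by auto
    have "twist t f z - twist t f z' = pt (x - x') (t * f (y - y'))"
      using z z' by (simp add: twist_pt pt_diff diff right_diff_distrib)
    moreover have "(t * f (y - y')) ^ (r + 1) = (y - y') ^ (r + 1)"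
      using fK(2)[OF K'(2)] unit_normD[OF t] by (simp only: power_mult_distrib mult_1)
    moreover have "t * f (y - y') = 0 \<longleftrightarrow> y - y' = 0"
      using f_0[OF K'(2)] unit_normD[OF t] by simp
    ultimately show ?thesis
      using pt_S_iff[OF K'] pt_S_iff[OF K'(1) tfK[OF K'(2)]] z z' by (simp only: pt_diff)
  qed
  ultimately show ?thesis by (simp add: graph_isomorphism_def Cay_def)
qed

lemma twist_lin_clique:
  "norm_additive f \<Longrightarrow> twist t f ` lin_clique 1 = (\<lambda>x. pt x (t * f x)) ` K"
  unfolding lin_clique_def image_image by (intro image_cong) (auto simp: twist_pt)

lemma lin_clique_twist: "lin_clique t = twist t (\<lambda>x. x) ` lin_clique 1"
  by (subst twist_lin_clique[OF norm_additive_id]) (simp add: lin_clique_def)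

lemma frob_clique_twist: "frob_clique t = twist t (\<lambda>x. x ^ r) ` lin_clique 1"
  by (subst twist_lin_clique[OF norm_additive_frobenius]) (simp add: frob_clique_def)

lemma lin_clique_line: "lin_clique t = line K (pt 1 t)"
  by (auto simp: lin_clique_def line_def pt_def algebra_simps)

lemma clique_automorphism: "automorphism (Cay S) f \<Longrightarrow> clique (Cay S) C \<Longrightarrow> clique (Cay S) (f ` C)"
  by (auto simp: clique_def graph_isomorphism_def Cay_def)

lemma lin_clique_1: "clique (Cay S) (lin_clique 1)"
  unfolding clique_Cay lin_clique_def
  using pt_S_iff subfield_diff[OF K] by (auto simp: pt_diff)

lemma lin_clique_clique: "t \<in> unit_norm \<Longrightarrow> clique (Cay S) (lin_clique t)"
  unfolding lin_clique_twist[of t]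
  by (intro clique_automorphism twist_automorphism norm_additive_id lin_clique_1)

lemma frob_clique_clique: "t \<in> unit_norm \<Longrightarrow> clique (Cay S) (frob_clique t)"
  unfolding frob_clique_twist[of t]
  by (intro clique_automorphism twist_automorphism norm_additive_frobenius lin_clique_1)

lemma card_lin_clique: "t \<in> K \<Longrightarrow> card (lin_clique t) = r ^ 2"
  unfolding lin_clique_def using pt_eq_iff subfield_mult[OF K]
  by (subst card_image) (auto intro!: inj_onI simp: card_K)

lemma card_frob_clique: "t \<in> K \<Longrightarrow> card (frob_clique t) = r ^ 2"
  unfolding frob_clique_def using pt_eq_iff subfield_mult[OF K] subfield_power[OF K]
  by (subst card_image) (auto intro!: inj_onI simp: card_K)

lemma zero_in_lin_clique: "0 \<in> lin_clique t"
  unfolding lin_clique_def using subfield_0[OF K] pt_0 by (intro image_eqI[of _ _ 0]) auto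

lemma zero_in_frob_clique: "0 \<in> frob_clique t"
  unfolding frob_clique_def using subfield_0[OF K] pt_0 r_ge_2
  by (intro image_eqI[of _ _ 0]) (auto simp: power_0_left)

lemma pt_in_lin_clique: "x \<in> K \<Longrightarrow> y \<in> K \<Longrightarrow> t \<in> K \<Longrightarrow> pt x y \<in> lin_clique t \<longleftrightarrow> y = t * x"
  unfolding lin_clique_def using pt_eq_iff subfield_mult[OF K] by (auto simp: image_iff)

lemma pt_in_frob_clique: "x \<in> K \<Longrightarrow> y \<in> K \<Longrightarrow> t \<in> K \<Longrightarrow> pt x y \<in> frob_clique t \<longleftrightarrow> y = t * x ^ r"
  unfolding frob_clique_def using pt_eq_iff subfield_mult[OF K] subfield_power[OF K]
  by (auto simp: image_iff)

text \<open>Equality at \<open>x = 1\<close> gives \<open>t = s\<close>, and then Frobenius would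
  fix all of \<open>K\<close>.\<close>

lemma frob_clique_neq_lin_clique:
  assumes "t \<in> unit_norm" "s \<in> K"
  shows "frob_clique t \<noteq> lin_clique s"
proof
  assume eq: "frob_clique t = lin_clique s"
  have t: "t \<in> K" "t \<noteq> 0" using unit_normD[OF assms(1)] by auto
  have all: "t * x ^ r = s * x" if "x \<in> K" for x
    using pt_in_frob_clique[of x "t * x ^ r" t] pt_in_lin_clique[of x "t * x ^ r" s] that t assms(2) eq
      subfield_mult[OF K] subfield_power[OF K] by simp
  have "t = s" using all[of 1] subfield_1[OF K] by simp
  then have "K \<subseteq> k" using all t k_iff by auto
  then show False using exists_K_not_k by blast
qed

text \<open>The \<open>r + 1\<close> lines of norm-one slope lie in \<open>S\<close>, which has only
  \<open>r + 1\<close> directions.\<close>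

lemma directions_in_S: "directions_in K S = lin_clique ` unit_norm"
proof (rule card_subset_eq[symmetric])
  show "lin_clique ` unit_norm \<subseteq> directions_in K S"
  proof
    fix L assume "L \<in> lin_clique ` unit_norm"
    then obtain t where t: "t \<in> unit_norm" "L = line K (pt 1 t)" by (auto simp: lin_clique_line)
    then have "pt 1 t \<in> S" using pt_S_iff[of 1 t] subfield_1[OF K] unit_normD[OF t(1)] by simp
    then show "L \<in> directions_in K S" using in_peisert_iff[OF peisert] t by simp
  qed
  have "inj_on lin_clique unit_norm"
  proof (rule inj_onI)
    fix t s assume ts: "t \<in> unit_norm" "s \<in> unit_norm" "lin_clique t = lin_clique s"
    then show "t = s"
      using pt_in_lin_clique[of 1 t t] pt_in_lin_clique[of 1 t s] unit_normD subfield_1[OF K] by simp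
  qed
  then show "card (lin_clique ` unit_norm) = card (directions_in K S)"
    using peisert_typeD(2)[OF peisert] by (simp add: card_image card_unit_norm)
qed simp

lemma inj_frob_clique: "inj_on frob_clique unit_norm"
proof (rule inj_onI)
  fix t s assume ts: "t \<in> unit_norm" "s \<in> unit_norm" "frob_clique t = frob_clique s"
  then show "t = s"
    using pt_in_frob_clique[of 1 t t] pt_in_frob_clique[of 1 t s] unit_normD subfield_1[OF K] by simp
qed

text \<open>Each nonzero point of the clique carries two labels, \<open>y / x\<close> and
  \<open>y / x ^ r\<close>, and any two such points share one of them. Sharing the first throughout
  puts the clique in a line, sharing the second in a Frobenius graph.\<close>

lemma clique_through_0:
  assumes C: "clique (Cay S) C" "0 \<in> C"
  shows "\<exists>t\<in>unit_norm. C \<subseteq> lin_clique t \<or> C \<subseteq> frob_clique t"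
proof -
  define a where "a z = snd (coords z) / fst (coords z)" for z
  define b where "b z = snd (coords z) / fst (coords z) ^ r" for z
  have ex: "\<exists>x\<in>K. \<exists>y\<in>K. x \<noteq> 0 \<and> y \<noteq> 0 \<and> z = pt x y \<and> x ^ (r + 1) = y ^ (r + 1) \<and>
    a z = y / x \<and> b z = y / x ^ r \<and> a z \<in> unit_norm \<and> b z \<in> unit_norm"
    if "z \<in> C" "z \<noteq> 0" for z
  proof -
    obtain x y where z: "x \<in> K" "y \<in> K" "z = pt x y" by (rule pt_cases)
    have "z - 0 \<in> S" using that C unfolding clique_Cay by blast
    then have n: "x \<noteq> 0 \<or> y \<noteq> 0" "x ^ (r + 1) = y ^ (r + 1)" using pt_S_iff z by auto
    then have n0: "x \<noteq> 0" "y \<noteq> 0" by auto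
    have ab: "a z = y / x" "b z = y / x ^ r" using z by (simp_all add: a_def b_def coords_pt)
    have "a z \<in> unit_norm" unfolding ab unit_norm_def
      using z n n0 subfield_divide[OF K] by (simp add: power_divide)
    moreover have "(y / x ^ r) ^ (r + 1) = 1"
      using n n0 by (simp only: power_divide norm_frobenius[OF z(1)]) simp
    then have "b z \<in> unit_norm" unfolding ab unit_norm_def
      using z subfield_divide[OF K] subfield_power[OF K] by simp
    ultimately show ?thesis using z n n0 ab by blast
  qed
  have pair: "a z = a z' \<or> b z = b z'" 
    if zC: "z \<in> C" "z \<noteq> 0" "z' \<in> C" "z' \<noteq> 0" for z z'
  proof (cases "z = z'")
    case False
    obtain x y where z: "x \<in> K" "y \<in> K" "x \<noteq> 0" "y \<noteq> 0" "z = pt x y" "x ^ (r + 1) = y ^ (r + 1)"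
      "a z = y / x" "b z = y / x ^ r" using ex[OF zC(1,2)] by blast
    obtain x' y' where z': "x' \<in> K" "y' \<in> K" "x' \<noteq> 0" "y' \<noteq> 0" "z' = pt x' y'" "x' ^ (r + 1) = y' ^ (r + 1)"
      "a z' = y' / x'" "b z' = y' / x' ^ r" using ex[OF zC(3,4)] by blast
    have "z - z' \<in> S" using C zC False unfolding clique_Cay by blast
    then have "(x - x') ^ (r + 1) = (y - y') ^ (r + 1)"
      using pt_S_iff[of "x - x'" "y - y'"] z z' subfield_diff[OF K] by (simp add: pt_diff)
    then have "(x - x') * (x ^ r - x' ^ r) = (y - y') * (y ^ r - y' ^ r)"
      by (simp add: frobenius_diff)
    moreover have e: "x * x ^ r = y * y ^ r" "x' * x' ^ r = y' * y' ^ r" using z(6) z'(6) by auto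
    ultimately have tr: "x * x' ^ r + x' * x ^ r = y * y' ^ r + y' * y ^ r"
      by (simp add: algebra_simps)
    \<comment> \<open>The conjugate pairs \<open>x x'\<^sup>r, x' x\<^sup>r\<close> and \<open>y y'\<^sup>r, y' y\<^sup>r\<close> have the same sum and the same product.\<close>
    have "(x * x' ^ r - y * y' ^ r) * (x * x' ^ r - y' * y ^ r) =
      x * x' ^ r * (x * x' ^ r) - x * x' ^ r * (y * y' ^ r + y' * y ^ r) + (y * y ^ r) * (y' * y' ^ r)"
      by (simp add: algebra_simps)
    also have "\<dots> = 0" unfolding tr[symmetric] e[symmetric] by (simp add: algebra_simps)
    finally consider "x * x' ^ r = y * y' ^ r" | "x * x' ^ r = y' * y ^ r" by auto
    then show ?thesis
    proof cases
      case 1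
      then have "(x * y') * x' ^ r = y * (x' * x' ^ r)" unfolding e by (simp add: algebra_simps)
      then have "(x * y') * x' ^ r = (y * x') * x' ^ r" by (simp add: mult.assoc)
      then have "x * y' = y * x'" using z' by simp
      then have "y / x = y' / x'" using z(3) z'(3) by (simp add: field_simps)
      then show ?thesis using z(7) z'(7) by simp
    next
      case 2
      then have "(y * x' ^ r) * x = y' * (x * x ^ r)" unfolding e by (simp add: algebra_simps)
      then have "(y * x' ^ r) * x = (y' * x ^ r) * x" by (simp add: ac_simps)
      then have "y * x' ^ r = y' * x ^ r" using z by simp
      then have "y / x ^ r = y' / x' ^ r" using z(3) z'(3) by (simp add: field_simps)
      then show ?thesis using z(8) z'(8) by simp
    qed
  qed simp
  show ?thesis
  proof (cases "C = {0}")
    case True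
    then show ?thesis using zero_in_lin_clique one_unit_norm by blast
  next
    case False
    then obtain z0 where z0: "z0 \<in> C" "z0 \<noteq> 0" using C(2) by blast
    show ?thesis
    proof (cases "\<forall>z\<in>C - {0}. a z = a z0")
      case True
      have "z \<in> lin_clique (a z0)" if zC: "z \<in> C" for z
      proof (cases "z = 0")
        case False
        obtain x y where z: "x \<in> K" "x \<noteq> 0" "y \<in> K" "z = pt x y" "a z = y / x"
          using ex[OF zC False] by blast
        then have "y = a z0 * x" using True zC False by simp
        then show ?thesis using z unfolding lin_clique_def by blast
      qed (simp add: zero_in_lin_clique)
      then show ?thesis using ex[OF z0] by blast
    next
      case no: False
      then obtain z1 where z1: "z1 \<in> C" "z1 \<noteq> 0" "a z1 \<noteq> a z0" by blast
      \<comment> \<open>The first labels of \<open>z0\<close> and \<open>z1\<close> differ, so these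
        two share the second, and \<open>z\<close> shares the second with at least one of
        them.\<close>
      have b_eq: "b z = b z0" if "z \<in> C" "z \<noteq> 0" for z
        using pair[OF that z0] pair[OF that z1(1,2)] pair[OF z0 z1(1,2)] z1(3) by metis
      have "z \<in> frob_clique (b z0)" if zC: "z \<in> C" for z
      proof (cases "z = 0")
        case False
        obtain x y where z: "x \<in> K" "x \<noteq> 0" "y \<in> K" "z = pt x y" "b z = y / x ^ r"
          using ex[OF zC False] by blast
        then have "y = b z0 * x ^ r" using b_eq[OF zC False] by (simp add: field_simps)
        then show ?thesis using z unfolding frob_clique_def by blast
      qed (simp add: zero_in_frob_clique)
      then show ?thesis using ex[OF z0] by blast
    qed
  qed
qed

section \<open>Maximum cliques through 0, their orbit, and maximal cliques\<close>

lemma canonical_cliques_0: "{C. canonical_clique K S C \<and> 0 \<in> C} = lin_clique ` unit_norm"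
proof (intro equalityI subsetI)
  fix C assume "C \<in> {C. canonical_clique K S C \<and> 0 \<in> C}"
  then obtain x L where L: "L \<in> directions_in K S" "C = (+) x ` L" "0 \<in> C"
    by (auto simp: canonical_clique_iff)
  then have LD: "L \<in> directions K" using directions_in_subset by blast
  have "x + l = 0" if "l \<in> L" "0 = x + l" for l using that by simp
  then have "- x \<in> L" using L(2,3) by (auto simp: minus_unique)
  then have "x \<in> L" using directions_uminus[OF LD, of "- x"] by simp
  then have "(+) x ` L \<subseteq> L" using directions_add[OF LD] by auto
  \<comment> \<open>A translate of a line that passes through 0 is the line itself.\<close>
  then have "(+) x ` L = L" by (intro card_subset_eq) (auto simp: card_image)
  then show "C \<in> lin_clique ` unit_norm" using L directions_in_S by simp
next
  fix C assume C: "C \<in> lin_clique ` unit_norm"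
  moreover have "C = (+) 0 ` C" by simp
  ultimately show "C \<in> {C. canonical_clique K S C \<and> 0 \<in> C}"
    using zero_in_lin_clique unfolding canonical_clique_iff directions_in_S by blast
qed

lemma card_canonical_cliques_0: "card {C. canonical_clique K S C \<and> 0 \<in> C} = r + 1"
  unfolding canonical_cliques_0 using directions_in_S peisert_typeD(2)[OF peisert] by simp

lemma maximum_clique_lin: "t \<in> unit_norm \<Longrightarrow> maximum_clique (Cay S) (lin_clique t)"
  using maximum_clique_iff[OF peisert] lin_clique_clique card_lin_clique unit_normD by blast

lemma maximum_clique_frob: "t \<in> unit_norm \<Longrightarrow> maximum_clique (Cay S) (frob_clique t)"
  using maximum_clique_iff[OF peisert] frob_clique_clique card_frob_clique unit_normD by blast

lemma noncanonical_cliques_0: "{C. noncanonical_clique K S C \<and> 0 \<in> C} = frob_clique ` unit_norm"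
proof (intro equalityI subsetI)
  fix C assume "C \<in> {C. noncanonical_clique K S C \<and> 0 \<in> C}"
  then have C: "clique (Cay S) C" "card C = r ^ 2" "0 \<in> C" "\<not> canonical_clique K S C"
    using maximum_clique_iff[OF peisert] by (auto simp: noncanonical_clique_def)
  obtain t where t: "t \<in> unit_norm" "C \<subseteq> lin_clique t \<or> C \<subseteq> frob_clique t"
    using clique_through_0[OF C(1,3)] by blast
  then have "C = lin_clique t \<or> C = frob_clique t"
    using card_subset_eq[of "lin_clique t" C] card_subset_eq[of "frob_clique t" C]
      card_lin_clique card_frob_clique unit_normD[OF t(1)] C(2) by auto
  moreover have "C \<noteq> lin_clique t" using C t(1) canonical_cliques_0 by blast
  ultimately show "C \<in> frob_clique ` unit_norm" using t(1) by blast
next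
  fix C assume "C \<in> frob_clique ` unit_norm"
  then obtain t where t: "t \<in> unit_norm" "C = frob_clique t" by blast
  have "C \<notin> lin_clique ` unit_norm" using frob_clique_neq_lin_clique[OF t(1)] t(2) unit_normD by blast
  then have "\<not> canonical_clique K S C" using canonical_cliques_0 zero_in_frob_clique t(2) by blast
  then show "C \<in> {C. noncanonical_clique K S C \<and> 0 \<in> C}"
    using maximum_clique_frob t zero_in_frob_clique by (auto simp: noncanonical_clique_def)
qed

lemma card_noncanonical_cliques_0: "card {C. noncanonical_clique K S C \<and> 0 \<in> C} = r + 1"
  unfolding noncanonical_cliques_0 using inj_frob_clique by (simp add: card_image card_unit_norm)

lemma cliques_0_one_orbit:
  "{C. (canonical_clique K S C \<or> noncanonical_clique K S C) \<and> 0 \<in> C} \<subseteq> set_orbit (Cay S) (lin_clique 1)"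
proof -
  have "{C. (canonical_clique K S C \<or> noncanonical_clique K S C) \<and> 0 \<in> C} =
    lin_clique ` unit_norm \<union> frob_clique ` unit_norm"
    using canonical_cliques_0 noncanonical_cliques_0 by blast
  moreover have "lin_clique t \<in> set_orbit (Cay S) (lin_clique 1)" if "t \<in> unit_norm" for t
    unfolding set_orbit_def lin_clique_twist[of t]
    using twist_automorphism[OF that norm_additive_id] by blast
  moreover have "frob_clique t \<in> set_orbit (Cay S) (lin_clique 1)" if "t \<in> unit_norm" for t
    unfolding set_orbit_def frob_clique_twist[of t]
    using twist_automorphism[OF that norm_additive_frobenius] by blast
  ultimately show ?thesis by (simp only: Un_subset_iff image_subset_iff) simp
qed

text \<open>After translating a point to 0, the clique lies in one of the cliques of size
  \<open>r ^ 2\<close> from \<open>clique_through_0\<close>, and maximality gives equality.\<close>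

lemma maximal_imp_maximum:
  assumes "maximal_clique (Cay S) C"
  shows "maximum_clique (Cay S) C"
proof -
  have C: "clique (Cay S) C" and max: "\<And>D. clique (Cay S) D \<Longrightarrow> C \<subseteq> D \<Longrightarrow> D = C"
    using assms by (auto simp: maximal_clique_def)
  have "C \<noteq> {}" using max[of "{0}"] by (auto simp: clique_Cay)
  then obtain p where p: "p \<in> C" by blast
  define B where "B = (+) (- p) ` C"
  have CB: "C = (+) p ` B" by (simp add: B_def image_image)
  have "clique (Cay S) B" unfolding B_def clique_Cay_translate by (rule C)
  moreover have "0 \<in> B" unfolding B_def using p by (intro image_eqI[of _ _ p]) auto
  ultimately obtain t where t: "t \<in> unit_norm" "B \<subseteq> lin_clique t \<or> B \<subseteq> frob_clique t"
    using clique_through_0 by blast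
  then obtain M where M: "B \<subseteq> M" "maximum_clique (Cay S) M"
    using maximum_clique_lin[OF t(1)] maximum_clique_frob[OF t(1)] by blast
  have "clique (Cay S) ((+) p ` M)" "card ((+) p ` M) = r ^ 2"
    using M(2) maximum_clique_iff[OF peisert] by (auto simp: clique_Cay_translate card_image)
  then have "maximum_clique (Cay S) ((+) p ` M)" "(+) p ` M = C"
    using maximum_clique_iff[OF peisert, of "(+) p ` M"] max[of "(+) p ` M"]
      image_mono[OF M(1), of "(+) p"] unfolding CB[symmetric] by simp_all
  then show ?thesis by simp
qed

end

section \<open>Strong regularity and eigenfunctions\<close>

lemma isomorphic_sym:
  assumes "isomorphic G H"
  shows "isomorphic H G"
proof -
  obtain f where f: "bij_betw f (verts G) (verts H)"
    and adj: "\<And>x y. x \<in> verts G \<Longrightarrow> y \<in> verts G \<Longrightarrow> adj G x y \<longleftrightarrow> adj H (f x) (f y)"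
    using assms by (auto simp: isomorphic_def graph_isomorphism_def)
  let ?g = "inv_into (verts G) f"
  have g: "?g x \<in> verts G \<and> f (?g x) = x" if "x \<in> verts H" for x
    using f that by (metis bij_betw_def f_inv_into_f inv_into_into)
  then have "graph_isomorphism ?g H G"
    using bij_betw_inv_into[OF f] adj unfolding graph_isomorphism_def by metis
  then show ?thesis by (auto simp: isomorphic_def)
qed

lemma isomorphic_trans:
  assumes "isomorphic G H" "isomorphic H J"
  shows "isomorphic G J"
proof -
  obtain f g where fg: "graph_isomorphism f G H" "graph_isomorphism g H J"
    using assms by (auto simp: isomorphic_def)
  then have "graph_isomorphism (g \<circ> f) G J"
    unfolding graph_isomorphism_def by (auto intro: bij_betw_trans dest: bij_betwE)
  then show ?thesis by (auto simp: isomorphic_def)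
qed

lemma nbhd_Cay: "nbhd (Cay S) z = {y. z - y \<in> S}"
  by (simp add: nbhd_def Cay_def)

lemma sum_nbhd_automorphism:
  assumes "automorphism G \<tau>" "z \<in> verts G"
  shows "(\<Sum>y\<in>nbhd G (\<tau> z). g y) = (\<Sum>y\<in>nbhd G z. g (\<tau> y))"
proof -
  have bij: "bij_betw \<tau> (verts G) (verts G)"
    and adj: "\<And>x y. x \<in> verts G \<Longrightarrow> y \<in> verts G \<Longrightarrow> adj G x y \<longleftrightarrow> adj G (\<tau> x) (\<tau> y)"
    using assms(1) by (auto simp: graph_isomorphism_def)
  have surj: "y \<in> \<tau> ` verts G" if "y \<in> verts G" for y using bij that by (simp add: bij_betw_def)
  have "nbhd G (\<tau> z) = \<tau> ` nbhd G z"
  proof (intro equalityI subsetI)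
    fix y assume y: "y \<in> nbhd G (\<tau> z)"
    then obtain x where "x \<in> verts G" "y = \<tau> x" using surj[of y] by (auto simp: nbhd_def)
    then show "y \<in> \<tau> ` nbhd G z" using y adj assms(2) by (auto simp: nbhd_def)
  next
    fix y assume "y \<in> \<tau> ` nbhd G z"
    then show "y \<in> nbhd G (\<tau> z)"
      using adj assms(2) bij_betwE[OF bij] by (auto simp: nbhd_def)
  qed
  moreover have "inj_on \<tau> (nbhd G z)"
    using bij by (auto simp: bij_betw_def nbhd_def intro: inj_on_subset)
  ultimately show ?thesis by (simp add: sum.reindex)
qed

section \<open>The adjacency operator as a combination of line sums\<close>

context field_tower
begin

definition line_sum :: "'f set \<Rightarrow> ('f \<Rightarrow> real) \<Rightarrow> 'f \<Rightarrow> real" where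
  "line_sum L f z = (\<Sum>y | z - y \<in> L. f y)"

definition nsum :: "'f set \<Rightarrow> ('f \<Rightarrow> real) \<Rightarrow> 'f \<Rightarrow> real" where
  "nsum S f z = (\<Sum>y\<in>nbhd (Cay S) z. f y)"

lemma card_translate: "card {y. z - y \<in> A} = card (A :: 'f set)"
proof -
  have "{y. z - y \<in> A} = (-) z ` A" by (auto intro: image_eqI[of _ _ "z - _"])
  then show ?thesis by (simp add: card_image)
qed

text \<open>The lines through \<open>z\<close> in the \<open>m\<close> directions share only
  \<open>z\<close>, which is not its own neighbour but is counted \<open>m\<close> times.\<close>

lemma nsum_eq:
  assumes "peisert_type K m S"
  shows "nsum S f z = (\<Sum>L\<in>directions_in K S. line_sum L f z) - real m * f z"
proof -
  let ?D = "directions_in K S"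
  have "s \<in> S \<longleftrightarrow> (\<exists>L\<in>?D. s \<in> L) \<and> s \<noteq> 0" for s using peisert_typeD(1)[OF assms] by blast
  then have "nbhd (Cay S) z = (\<Union>L\<in>?D. {y. z - y \<in> L} - {z})" by (auto simp: nbhd_Cay)
  then have "nsum S f z = sum f (\<Union>L\<in>?D. {y. z - y \<in> L} - {z})" by (simp add: nsum_def)
  also have "\<dots> = (\<Sum>L\<in>?D. \<Sum>y\<in>{y. z - y \<in> L} - {z}. f y)"
  proof (rule sum.UNION_disjoint)
    have "L = M" if "L \<in> ?D" "M \<in> ?D" "z - y \<in> L" "z - y \<in> M" "y \<noteq> z" for L M y
      using directions_eq[of L "z - y"] directions_eq[of M "z - y"] that directions_in_subset by auto
    then show "\<forall>L\<in>?D. \<forall>M\<in>?D. L \<noteq> M \<longrightarrow>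
      ({y. z - y \<in> L} - {z}) \<inter> ({y. z - y \<in> M} - {z}) = {}" by blast
  qed auto
  also have "\<dots> = (\<Sum>L\<in>?D. line_sum L f z - f z)"
  proof (rule sum.cong)
    fix L assume "L \<in> ?D"
    then have "0 \<in> L" using directions_0 directions_in_subset by blast
    then show "(\<Sum>y\<in>{y. z - y \<in> L} - {z}. f y) = line_sum L f z - f z"
      by (simp add: line_sum_def sum_diff1)
  qed simp
  finally show ?thesis using peisert_typeD(2)[OF assms] by (simp add: sum_subtractf)
qed

lemma line_sum_same:
  assumes "L \<in> directions K"
  shows "line_sum L (line_sum L f) z = real (r ^ 2) * line_sum L f z"
proof -
  have "line_sum L f y = line_sum L f z" if "z - y \<in> L" for y
  proof -
    have "y - x \<in> L \<longleftrightarrow> z - x \<in> L" for x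
      using directions_diff[OF assms, of "z - x" "z - y"] directions_add[OF assms, of "y - x" "z - y"] that
      by auto
    then show ?thesis by (simp add: line_sum_def)
  qed
  then have "line_sum L (line_sum L f) z = (\<Sum>y | z - y \<in> L. line_sum L f z)"
    unfolding line_sum_def[of L "line_sum L f"] by (intro sum.cong) auto
  then show ?thesis using card_direction[OF assms] by (simp add: card_translate)
qed

text \<open>A translate of \<open>L\<close> and a translate of \<open>M\<close> meet in exactly one
  point, so each \<open>w\<close> is counted once.\<close>

lemma line_sum_diff:
  assumes "L \<in> directions K" "M \<in> directions K" "L \<noteq> M"
  shows "line_sum L (line_sum M f) z = (\<Sum>w\<in>UNIV. f w)"
proof -
  have one: "card {y. z - y \<in> L \<and> y - w \<in> M} = 1" for w
  proof -
    obtain c d where c: "c \<noteq> 0" "L = line K c" and d: "d \<noteq> 0" "M = line K d"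
      using directionsE assms by metis
    then have "indep K c d" using indep_lines assms(3) by simp
    then obtain a b where ab: "a \<in> K" "b \<in> K" "z - w = c * a + d * b" by (rule indep_coords)
    have y: "z - (w + d * b) \<in> L" "w + d * b - w \<in> M"
      using ab c d mult_in_line by (auto simp: algebra_simps)
    have "y = w + d * b" if "z - y \<in> L" "y - w \<in> M" for y
    proof -
      have "z - y - (z - (w + d * b)) \<in> L" "w + d * b - w - (y - w) \<in> M"
        using directions_diff[OF assms(1) that(1) y(1)] directions_diff[OF assms(2) y(2) that(2)] .
      then have "w + d * b - y \<in> L \<inter> M" by (simp add: algebra_simps)
      then show ?thesis using directions_disjoint[OF assms] by simp
    qed
    then have "{y. z - y \<in> L \<and> y - w \<in> M} = {w + d * b}" using y by blast
    then show ?thesis by simp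
  qed
  have all: "line_sum N g x = (\<Sum>y\<in>UNIV. if x - y \<in> N then g y else 0)" for N g x
    by (simp add: line_sum_def sum.If_cases)
  have "line_sum L (line_sum M f) z = (\<Sum>y\<in>UNIV. \<Sum>w\<in>UNIV. if z - y \<in> L \<and> y - w \<in> M then f w else 0)"
    unfolding all by (rule sum.cong) (auto intro!: sum.cong)
  also have "\<dots> = (\<Sum>w\<in>UNIV. \<Sum>y\<in>UNIV. if z - y \<in> L \<and> y - w \<in> M then f w else 0)"
    by (rule sum.swap)
  also have "\<dots> = (\<Sum>w\<in>UNIV. f w)"
    using one by (simp add: sum.If_cases)
  finally show ?thesis .
qed

lemma nsum_line_sum:
  assumes "peisert_type K m S" "L \<in> directions_in K S"
  shows "nsum S (line_sum L f) z =
    (real (r ^ 2) - real m) * line_sum L f z + (real m - 1) * (\<Sum>w\<in>UNIV. f w)"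
proof -
  let ?D = "directions_in K S"
  have D: "M \<in> directions K" if "M \<in> ?D" for M using that directions_in_subset by blast
  have "(\<Sum>M\<in>?D. line_sum M (line_sum L f) z) =
    line_sum L (line_sum L f) z + (\<Sum>M\<in>?D - {L}. line_sum M (line_sum L f) z)"
    using assms(2) by (simp add: sum.remove)
  also have "(\<Sum>M\<in>?D - {L}. line_sum M (line_sum L f) z) = (\<Sum>M\<in>?D - {L}. \<Sum>w\<in>UNIV. f w)"
    using line_sum_diff D assms(2) by (intro sum.cong) auto
  also have "\<dots> = (real m - 1) * (\<Sum>w\<in>UNIV. f w)"
    using peisert_typeD[OF assms(1)] assms(2) by (simp add: card_Diff_singleton of_nat_diff)
  finally show ?thesis
    using nsum_eq[OF assms(1), of "line_sum L f" z] line_sum_same[OF D[OF assms(2)], of f z]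
    by (simp add: algebra_simps)
qed

text \<open>This is the quadratic equation of the adjacency matrix, with the total sum in the role
  of the all-ones matrix. Both the strong regularity and the eigenvalues are read off from
  it.\<close>

lemma nsum_nsum:
  assumes "peisert_type K m S"
  shows "nsum S (nsum S f) z = real m * (real m - 1) * (\<Sum>w\<in>UNIV. f w) +
    (real (r ^ 2) - 2 * real m) * nsum S f z + real m * (real (r ^ 2) - real m) * f z"
proof -
  let ?D = "directions_in K S" and ?s = "\<Sum>w\<in>UNIV. f w"
  have "nsum S (nsum S f) z = nsum S (\<lambda>y. (\<Sum>L\<in>?D. line_sum L f y) - real m * f y) z"
    using nsum_eq[OF assms] by (simp add: nsum_def)
  also have "\<dots> = (\<Sum>L\<in>?D. nsum S (line_sum L f) z) - real m * nsum S f z"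
    unfolding nsum_def sum_subtractf sum_distrib_left by (subst sum.swap) simp
  also have "(\<Sum>L\<in>?D. nsum S (line_sum L f) z) =
    (\<Sum>L\<in>?D. (real (r ^ 2) - real m) * line_sum L f z + (real m - 1) * ?s)"
    using nsum_line_sum[OF assms] by (intro sum.cong) auto
  also have "\<dots> = (real (r ^ 2) - real m) * (\<Sum>L\<in>?D. line_sum L f z) + real m * ((real m - 1) * ?s)"
    using peisert_typeD(2)[OF assms] by (simp add: sum.distrib sum_distrib_left)
  also have "(\<Sum>L\<in>?D. line_sum L f z) = nsum S f z + real m * f z"
    using nsum_eq[OF assms] by simp
  finally show ?thesis by (simp add: algebra_simps)
qed

text \<open>Applied twice to the point mass at \<open>y\<close>, the adjacency operator counts walks
  of length 2 from \<open>x\<close> to \<open>y\<close>.\<close>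

lemma card_common_neighbours:
  assumes "peisert_type K m S" "x \<noteq> y"
  shows "real (card (nbhd (Cay S) x \<inter> nbhd (Cay S) y)) =
    real m * (real m - 1) + (if x - y \<in> S then real (r ^ 2) - 2 * real m else 0)"
proof -
  let ?\<delta> = "\<lambda>z. if z = y then 1 else 0 :: real"
  have d: "nsum S ?\<delta> z = (if z \<in> nbhd (Cay S) y then 1 else 0)" for z
    using peisert_commute[OF assms(1), of y z] by (simp add: nsum_def nbhd_Cay sum.delta)
  have "real (card (nbhd (Cay S) x \<inter> nbhd (Cay S) y)) = nsum S (nsum S ?\<delta>) x"
    unfolding d by (simp add: nsum_def sum.If_cases)
  then show ?thesis
    unfolding nsum_nsum[OF assms(1)] d
    using assms(2) peisert_commute[OF assms(1), of y x] by (simp add: nbhd_Cay)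
qed

text \<open>Two adjacent directions suffice: walk along \<open>c\<close> and then along
  \<open>d\<close>. This serves the graph and its complement alike.\<close>

lemma connected_graphI:
  assumes "verts G = (UNIV :: 'f set)" "indep K c d"
    and "\<And>x a. a \<in> K \<Longrightarrow> a \<noteq> 0 \<Longrightarrow> adj G x (x + c * a)"
    and "\<And>x a. a \<in> K \<Longrightarrow> a \<noteq> 0 \<Longrightarrow> adj G x (x + d * a)"
  shows "connected_graph G"
  unfolding connected_graph_def
proof (intro ballI)
  fix x y
  let ?R = "{(u, v). u \<in> verts G \<and> v \<in> nbhd G u}"
  obtain a b where ab: "a \<in> K" "b \<in> K" "y - x = c * a + d * b" using indep_coords[OF assms(2)] .
  have "(x, x + c * a) \<in> ?R\<^sup>*"
    using assms(1) assms(3)[OF ab(1), of x] by (cases "a = 0") (auto simp: nbhd_def)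
  also have "(x + c * a, x + c * a + d * b) \<in> ?R\<^sup>*"
    using assms(1) assms(4)[OF ab(2), of "x + c * a"] by (cases "b = 0") (auto simp: nbhd_def)
  also have "x + c * a + d * b = y" using ab(3) by (simp add: algebra_simps)
  finally show "(x, y) \<in> ?R\<^sup>*" .
qed

lemma connected_Cay:
  assumes "peisert_type K m S" "2 \<le> m"
  shows "connected_graph (Cay S)"
proof -
  have "\<not> card (directions_in K S) \<le> Suc 0" using peisert_typeD(2)[OF assms(1)] assms(2) by simp
  then obtain L M where LM: "L \<in> directions_in K S" "M \<in> directions_in K S" "L \<noteq> M"
    using card_le_Suc0_iff_eq[of "directions_in K S"] by auto
  then obtain c d where c: "c \<noteq> 0" "L = line K c" and d: "d \<noteq> 0" "M = line K d"
    using directionsE directions_in_subset by (metis subsetD)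
  have "c \<in> S" "d \<in> S" using in_peisert_iff[OF assms(1)] c d LM by auto
  then have step: "- (e * a) \<in> S" if "e = c \<or> e = d" "a \<in> K" "a \<noteq> 0" for e a
    using that peisert_scale[OF assms(1)] peisert_uminus[OF assms(1)] by auto
  show ?thesis
  proof (rule connected_graphI)
    show "indep K c d" using indep_lines c d LM by simp
  qed (use step in \<open>auto simp: Cay_def\<close>)
qed

text \<open>
  Writing \<open>x\<close> and \<open>y\<close> in the basis \<open>1, w\<close> over \<open>k\<close> turns \<open>u x + v y\<close> into a \<open>2 \<times> 2\<close> matrix over \<open>k\<close>, and
  \<open>baer K k u v\<close> into the set of matrices of rank 1; the hyperbolic form is the determinant.
\<close>

lemma VO_plus_4_isomorphic_baer:
  assumes "indep K u v"
  shows "isomorphic (VO_plus_4 k) (Cay (baer K k u v))"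
proof -
  obtain w where w: "w \<in> K" "w \<notin> k" using exists_K_not_k by blast
  \<comment> \<open>The second vector uses the basis \<open>w, -1\<close>; this choice makes the
    mixed terms of \<open>X ^ r * Y - X * Y ^ r\<close> cancel and leaves \<open>w - w ^ r\<close>
    times the hyperbolic form.\<close>
  define X Y where "X = (\<lambda>z1 z3. z1 + w * z3)" and "Y = (\<lambda>z2 z4. w * z2 - z4)"
  define g where "g = (\<lambda>(z1, z2, z3, z4). u * X z1 z3 + v * Y z2 z4)"
  have XY: "X a b \<in> K" "Y a b \<in> K" if "a \<in> k" "b \<in> k" for a b
    using that w in_K subfield_closed[OF K] by (auto simp: X_def Y_def)
  have lin: "a = 0 \<and> b = 0" if "a \<in> k" "b \<in> k" "a + w * b = 0" for a b
  proof -
    have "b = 0"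
    proof (rule ccontr)
      assume "b \<noteq> 0"
      then have "w = - a / b" using that(3) by (simp add: field_simps eq_neg_iff_add_eq_0)
      moreover have "- a / b \<in> k" by (intro subfield_divide[OF k] subfield_uminus[OF k] that)
      ultimately show False using w by simp
    qed
    then show ?thesis using that by simp
  qed
  have X0: "X a b = 0 \<longleftrightarrow> a = 0 \<and> b = 0" if "a \<in> k" "b \<in> k" for a b
    using lin[OF that] by (auto simp: X_def)
  have Y0: "Y a b = 0 \<longleftrightarrow> a = 0 \<and> b = 0" if "a \<in> k" "b \<in> k" for a b
    using lin[of "- b" a] subfield_uminus[OF k] that by (auto simp: Y_def)
  have g_diff: "g (x1, x2, x3, x4) - g (y1, y2, y3, y4) = g (x1 - y1, x2 - y2, x3 - y3, x4 - y4)"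
    for x1 x2 x3 x4 y1 y2 y3 y4
    by (simp add: g_def X_def Y_def algebra_simps)
  have g_S: "g (z1, z2, z3, z4) \<in> baer K k u v \<longleftrightarrow>
      (z1, z2, z3, z4) \<noteq> (0, 0, 0, 0) \<and> hyperbolic_form (z1, z2, z3, z4) = 0"
    if z: "z1 \<in> k" "z2 \<in> k" "z3 \<in> k" "z4 \<in> k" for z1 z2 z3 z4
  proof -
    have pow: "z1 ^ r = z1" "z2 ^ r = z2" "z3 ^ r = z3" "z4 ^ r = z4" using z k_iff by auto
    have "X z1 z3 ^ r * Y z2 z4 - X z1 z3 * Y z2 z4 ^ r = (w - w ^ r) * (z1 * z2 + z3 * z4)"
      by (simp add: X_def Y_def frobenius_add frobenius_diff power_mult_distrib pow algebra_simps)
    moreover have "w - w ^ r \<noteq> 0" using w k_iff by auto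
    ultimately have "X z1 z3 ^ r * Y z2 z4 = X z1 z3 * Y z2 z4 ^ r \<longleftrightarrow> z1 * z2 + z3 * z4 = 0"
      by (metis eq_iff_diff_eq_0 mult_eq_0_iff)
    then show ?thesis
      using baer_iff[OF assms XY(1)[OF z(1,3)] XY(2)[OF z(2,4)]] X0[OF z(1,3)] Y0[OF z(2,4)]
      by (auto simp: g_def hyperbolic_form_def)
  qed
  have inj: "inj_on g (k \<times> k \<times> k \<times> k)"
  proof (rule inj_onI)
    fix x y assume "x \<in> k \<times> k \<times> k \<times> k" "y \<in> k \<times> k \<times> k \<times> k" and "g x = g y"
    then obtain x1 x2 x3 x4 y1 y2 y3 y4
      where xy: "x = (x1, x2, x3, x4)" "y = (y1, y2, y3, y4)"
        and z: "x1 \<in> k" "x2 \<in> k" "x3 \<in> k" "x4 \<in> k" "y1 \<in> k" "y2 \<in> k" "y3 \<in> k" "y4 \<in> k"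
        and eq: "g (x1, x2, x3, x4) = g (y1, y2, y3, y4)" by auto
    have k': "x1 - y1 \<in> k" "x2 - y2 \<in> k" "x3 - y3 \<in> k" "x4 - y4 \<in> k"
      using z subfield_diff[OF k] by auto
    have "g (x1 - y1, x2 - y2, x3 - y3, x4 - y4) = 0" using eq g_diff by (metis diff_self)
    then have "u * X (x1 - y1) (x3 - y3) + v * Y (x2 - y2) (x4 - y4) = 0" by (simp add: g_def)
    then have "X (x1 - y1) (x3 - y3) = 0 \<and> Y (x2 - y2) (x4 - y4) = 0"
      by (rule indepD[OF assms XY(1)[OF k'(1,3)] XY(2)[OF k'(2,4)]])
    then show "x = y"
      unfolding xy using X0[OF k'(1,3)] Y0[OF k'(2,4)] by simp
  qed
  have "r * (r * (r * r)) = r ^ 4" by (simp add: numeral_eq_Suc)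
  then have "g ` (k \<times> k \<times> k \<times> k) = UNIV"
    by (intro card_subset_eq) (auto simp: card_image[OF inj] card_cartesian_product card_k card_UNIV)
  then have bij: "bij_betw g (k \<times> k \<times> k \<times> k) UNIV" using inj by (simp add: bij_betw_def)
  have "graph_isomorphism g (VO_plus_4 k) (Cay (baer K k u v))"
    unfolding graph_isomorphism_def
  proof (intro conjI ballI)
    show "bij_betw g (verts (VO_plus_4 k)) (verts (Cay (baer K k u v)))"
      using bij by (simp add: VO_plus_4_def Cay_def)
    fix x y assume "x \<in> verts (VO_plus_4 k)" "y \<in> verts (VO_plus_4 k)"
    then obtain x1 x2 x3 x4 y1 y2 y3 y4
      where xy: "x = (x1, x2, x3, x4)" "y = (y1, y2, y3, y4)"
        and z: "x1 \<in> k" "x2 \<in> k" "x3 \<in> k" "x4 \<in> k" "y1 \<in> k" "y2 \<in> k" "y3 \<in> k" "y4 \<in> k"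
      by (auto simp: VO_plus_4_def)
    have k': "x1 - y1 \<in> k" "x2 - y2 \<in> k" "x3 - y3 \<in> k" "x4 - y4 \<in> k"
      using z subfield_diff[OF k] by auto
    show "adj (VO_plus_4 k) x y \<longleftrightarrow> adj (Cay (baer K k u v)) (g x) (g y)"
      unfolding xy using g_S[OF k'] by (simp add: VO_plus_4_def Cay_def g_diff)
  qed
  then show ?thesis by (auto simp: isomorphic_def)
qed

end

section \<open>Parameters, eigenvalues and tight eigenfunctions\<close>

context norm_coords
begin

lemma nonadjacent_axes:
  assumes "a \<in> K" "a \<noteq> 0"
  shows "u * a \<notin> S" "v * a \<notin> S"
  using pt_S_iff[of a 0] pt_S_iff[of 0 a] assms subfield_0[OF K] by (auto simp: pt_def)

lemma card_nbhd: "card (nbhd (Cay S) x) = (r + 1) * (r ^ 2 - 1)"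
  unfolding nbhd_Cay card_translate by (rule card_peisert[OF peisert])

lemma strongly_regular_Cay:
  "strongly_regular (Cay S) ((r + 1) * (r ^ 2 - 1)) (r * (r + 1) + r ^ 2 - 2 * (r + 1)) (r * (r + 1))"
  unfolding strongly_regular_def
proof (intro conjI ballI impI)
  show "simple_graph (Cay S)"
    unfolding simple_graph_def
    using peisert_no_0[OF peisert] peisert_commute[OF peisert] by (simp add: Cay_def)
  have "card S > 0" using card_peisert[OF peisert] r_less_q r_ge_2 by simp
  then obtain s where "s \<in> S" by fastforce
  then show "\<exists>x\<in>verts (Cay S). \<exists>y\<in>verts (Cay S). adj (Cay S) x y"
    by (simp add: Cay_def) (metis diff_zero)
  show "\<exists>x\<in>verts (Cay S). \<exists>y\<in>verts (Cay S). x \<noteq> y \<and> \<not> adj (Cay S) x y"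
    using nonadjacent_axes(1)[of 1] subfield_1[OF K] indep_nonzero[OF indep]
    by (simp add: Cay_def) (metis diff_zero)
  show "card (nbhd (Cay S) x) = (r + 1) * (r ^ 2 - 1)" for x by (rule card_nbhd)
  \<comment> \<open>Keeps the subtraction on natural numbers in the parameter from
    truncating.\<close>
  have le: "2 * (r + 1) \<le> r * (r + 1) + r ^ 2"
    using r_ge_2 by (intro trans_le_add1 mult_right_mono) auto
  fix x y
  show "card (nbhd (Cay S) x \<inter> nbhd (Cay S) y) = r * (r + 1) + r ^ 2 - 2 * (r + 1)"
    if "adj (Cay S) x y"
  proof -
    have "x - y \<in> S" "x \<noteq> y" using that peisert_no_0[OF peisert] by (auto simp: Cay_def)
    then have "real (card (nbhd (Cay S) x \<inter> nbhd (Cay S) y)) =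
        real (r * (r + 1) + r ^ 2 - 2 * (r + 1))"
      unfolding card_common_neighbours[OF peisert \<open>x \<noteq> y\<close>] of_nat_diff[OF le]
      by (simp add: algebra_simps)
    then show ?thesis by (simp only: of_nat_eq_iff)
  qed
  show "card (nbhd (Cay S) x \<inter> nbhd (Cay S) y) = r * (r + 1)"
    if "x \<noteq> y \<and> \<not> adj (Cay S) x y"
  proof -
    have "x - y \<notin> S" "x \<noteq> y" using that by (auto simp: Cay_def)
    then have "real (card (nbhd (Cay S) x \<inter> nbhd (Cay S) y)) = real (r * (r + 1))"
      unfolding card_common_neighbours[OF peisert \<open>x \<noteq> y\<close>] by (simp add: algebra_simps)
    then show ?thesis by (simp only: of_nat_eq_iff)
  qed
qed

lemma primitive_strongly_regular_Cay:
  "primitive_strongly_regular (Cay S) ((r + 1) * (r ^ 2 - 1))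
     (r * (r + 1) + r ^ 2 - 2 * (r + 1)) (r * (r + 1))"
  unfolding primitive_strongly_regular_def
proof (intro conjI)
  show "connected_graph (Cay S)" by (rule connected_Cay[OF peisert]) (use r_ge_2 in simp)
  show "connected_graph (graph_complement (Cay S))"
  proof (rule connected_graphI[OF _ indep])
    show "verts (graph_complement (Cay S)) = UNIV" by (simp add: graph_complement_def Cay_def)
    fix x a assume "a \<in> K" "a \<noteq> 0"
    then show "adj (graph_complement (Cay S)) x (x + u * a)" "adj (graph_complement (Cay S)) x (x + v * a)"
      using nonadjacent_axes[of a] peisert_uminus[OF peisert, of "u * a"] peisert_uminus[OF peisert, of "v * a"]
        indep_nonzero[OF indep]
      by (auto simp: graph_complement_def Cay_def)
  qed
qed (rule strongly_regular_Cay)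

lemma eigenfunction_Cay:
  "eigenfunction (Cay S) \<theta> f \<longleftrightarrow> (\<exists>x. f x \<noteq> 0) \<and> (\<forall>x. \<theta> * f x = nsum S f x)"
  by (auto simp: eigenfunction_def Cay_def nsum_def)

text \<open>Summing the eigenvalue equation over all vertices forces the total of \<open>f\<close>
  to be 0, as \<theta> is not the valency. Then \<open>nsum_nsum\<close> becomes a quadratic
  equation for \<theta>.\<close>

lemma eigenvalue_cases:
  assumes "eigenfunction (Cay S) \<theta> f" "\<theta> \<noteq> real ((r + 1) * (r ^ 2 - 1))"
  shows "\<theta> = real (r ^ 2) - real (r + 1) \<or> \<theta> = - real (r + 1)"
proof -
  have ev: "nsum S f x = \<theta> * f x" for x using assms(1) by (simp add: eigenfunction_Cay)
  obtain x where x: "f x \<noteq> 0" using assms(1) by (auto simp: eigenfunction_Cay)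
  let ?s = "\<Sum>y\<in>UNIV. f y"
  have "\<theta> * ?s = (\<Sum>x\<in>UNIV. nsum S f x)" by (simp add: ev sum_distrib_left)
  also have "\<dots> = (\<Sum>x\<in>UNIV. \<Sum>y\<in>UNIV. if x - y \<in> S then f y else 0)"
    by (simp add: nsum_def nbhd_Cay sum.If_cases)
  also have "\<dots> = (\<Sum>y\<in>UNIV. \<Sum>x\<in>UNIV. if x - y \<in> S then f y else 0)"
    by (rule sum.swap)
  also have "\<dots> = (\<Sum>y\<in>UNIV. real (card (nbhd (Cay S) y)) * f y)"
  proof (rule sum.cong)
    fix y :: 'a
    have "{x. x - y \<in> S} = nbhd (Cay S) y" using peisert_commute[OF peisert] by (auto simp: nbhd_Cay)
    then show "(\<Sum>x\<in>UNIV. if x - y \<in> S then f y else 0) = real (card (nbhd (Cay S) y)) * f y"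
      by (simp add: sum.If_cases)
  qed simp
  finally have "\<theta> * ?s = real ((r + 1) * (r ^ 2 - 1)) * ?s"
    unfolding card_nbhd by (simp only: sum_distrib_left)
  then have s: "?s = 0" using assms(2) by (simp only: mult_cancel_right) blast
  have "nsum S (nsum S f) x = \<theta> * (\<theta> * f x)"
    unfolding ev[abs_def] by (simp add: nsum_def sum_distrib_left[symmetric]) (simp add: ev[unfolded nsum_def])
  then have "\<theta> * (\<theta> * f x) = (real (r ^ 2) - 2 * real (r + 1)) * (\<theta> * f x) +
      real (r + 1) * (real (r ^ 2) - real (r + 1)) * f x"
    unfolding nsum_nsum[OF peisert] s ev by simp
  then have "((\<theta> - (real (r ^ 2) - real (r + 1))) * (\<theta> + real (r + 1))) * f x = 0"
    by (simp add: algebra_simps)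
  then show ?thesis using x by auto
qed

abbreviation ind :: "'a set \<Rightarrow> 'a \<Rightarrow> real" where
  "ind A z \<equiv> (if z \<in> A then 1 else 0)"

text \<open>The indicator of a line is the line sum of the point mass at 0, whose total 1
  contributes the constant \<open>r\<close>.\<close>

lemma nsum_lin_clique_1:
  "nsum S (ind (lin_clique 1)) z = (real (r ^ 2) - real (r + 1)) * ind (lin_clique 1) z + real r"
proof -
  have L: "lin_clique 1 \<in> directions_in K S" using directions_in_S one_unit_norm by blast
  let ?\<delta> = "\<lambda>w. if w = 0 then 1 else 0 :: real"
  have "line_sum (lin_clique 1) ?\<delta> = ind (lin_clique 1)"
    by (rule ext) (simp add: line_sum_def sum.delta)
  then show ?thesis using nsum_line_sum[OF peisert L, of ?\<delta> z] by simp
qed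

text \<open>The equation for the line is transported along the automorphism that maps it to the
  Frobenius graph.\<close>

lemma nsum_frob_clique_1:
  "nsum S (ind (frob_clique 1)) z = (real (r ^ 2) - real (r + 1)) * ind (frob_clique 1) z + real r"
proof -
  let ?\<tau> = "twist 1 (\<lambda>x. x ^ r)"
  have aut: "automorphism (Cay S) ?\<tau>"
    by (rule twist_automorphism[OF one_unit_norm norm_additive_frobenius])
  then have bij: "bij ?\<tau>" by (simp add: graph_isomorphism_def Cay_def)
  then have ind_eq: "ind (frob_clique 1) (?\<tau> y) = ind (lin_clique 1) y" for y
    unfolding frob_clique_twist[of 1] by (simp add: inj_image_mem_iff bij_is_inj)
  obtain y where y: "z = ?\<tau> y" using bij by (metis bij_pointE)
  have "nsum S (ind (frob_clique 1)) z = (\<Sum>x\<in>nbhd (Cay S) y. ind (frob_clique 1) (?\<tau> x))"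
    unfolding nsum_def y by (rule sum_nbhd_automorphism[OF aut]) (simp add: Cay_def)
  also have "\<dots> = nsum S (ind (lin_clique 1)) y"
    unfolding ind_eq nsum_def ..
  finally have "nsum S (ind (frob_clique 1)) z = nsum S (ind (lin_clique 1)) y" .
  then show ?thesis unfolding y ind_eq nsum_lin_clique_1 .
qed

lemma card_lin_frob_inter: "card (lin_clique 1 \<inter> frob_clique 1) = r"
proof -
  have "lin_clique 1 \<inter> frob_clique 1 = (\<lambda>x. pt x x) ` k"
  proof (intro equalityI subsetI)
    fix z assume z: "z \<in> lin_clique 1 \<inter> frob_clique 1"
    then obtain x where x: "x \<in> K" "z = pt x x" by (auto simp: lin_clique_def)
    then have "x = x ^ r" using z pt_in_frob_clique[of x x 1] subfield_1[OF K] by simp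
    then show "z \<in> (\<lambda>x. pt x x) ` k" using x k_iff by auto
  next
    fix z assume "z \<in> (\<lambda>x. pt x x) ` k"
    then obtain x where x: "x \<in> k" "z = pt x x" by blast
    then show "z \<in> lin_clique 1 \<inter> frob_clique 1"
      using in_K[of x] k_iff[of x] pt_in_lin_clique[of x x 1] pt_in_frob_clique[of x x 1] subfield_1[OF K] by simp
  qed
  moreover have "inj_on (\<lambda>x. pt x x) k" using pt_eq_iff in_K by (auto intro: inj_onI)
  ultimately show ?thesis by (simp add: card_image card_k)
qed

text \<open>In the difference of the two indicators the constants \<open>r\<close> cancel. The
  cliques share \<open>r\<close> points, so the support has \<open>2 * (r ^ 2 - r)\<close>
  elements.\<close>

lemma tight_positive:
  defines "\<theta> \<equiv> real (r ^ 2) - real (r + 1)"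
  shows "0 < \<theta>" "weight_distribution_bound_tight (Cay S) \<theta>"
proof -
  have "2 * r \<le> r ^ 2" using r_ge_2 by (simp add: power2_eq_square)
  then have "r + 1 < r ^ 2" using r_ge_2 by linarith
  then show pos: "0 < \<theta>" unfolding \<theta>_def by (simp only: diff_gt_0_iff_gt of_nat_less_iff)
  let ?L = "lin_clique 1" and ?M = "frob_clique 1"
  let ?f = "\<lambda>z. ind ?L z - ind ?M z"
  have card_LM: "card ?L = r ^ 2" "card ?M = r ^ 2"
    using card_lin_clique card_frob_clique subfield_1[OF K] by auto
  have support: "{z. ?f z \<noteq> 0} = (?L - ?M) \<union> (?M - ?L)" by auto
  have "card {z. ?f z \<noteq> 0} = (r ^ 2 - r) + (r ^ 2 - r)"
    unfolding support
    by (subst card_Un_disjoint)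
      (auto simp: card_Diff_subset_Int card_LM card_lin_frob_inter Int_commute[of ?M])
  moreover have "r \<le> r ^ 2" using r_less_q by simp
  ultimately have "real (card {z. ?f z \<noteq> 0}) = 2 * (\<theta> + 1)"
    unfolding \<theta>_def by (simp add: of_nat_diff)
  moreover have "eigenfunction (Cay S) \<theta> ?f"
    unfolding eigenfunction_Cay
  proof
    have "card (?L - ?M) = r ^ 2 - r"
      by (simp add: card_Diff_subset_Int card_LM card_lin_frob_inter)
    then have "card (?L - ?M) > 0" using \<open>r + 1 < r ^ 2\<close> by linarith
    then have "?L - ?M \<noteq> {}" by (simp only: card_gt_0_iff) blast
    then show "\<exists>x. ?f x \<noteq> 0" using support by auto
    show "\<forall>x. \<theta> * ?f x = nsum S ?f x"
    proof
      fix x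
      have "nsum S ?f x = nsum S (ind ?L) x - nsum S (ind ?M) x"
        by (simp add: nsum_def sum_subtractf)
      then show "\<theta> * ?f x = nsum S ?f x"
        unfolding nsum_lin_clique_1 nsum_frob_clique_1 \<theta>_def by (simp add: algebra_simps)
    qed
  qed
  ultimately show "weight_distribution_bound_tight (Cay S) \<theta>"
    unfolding weight_distribution_bound_tight_def weight_distribution_bound_def
    using pos by (intro exI[of _ ?f]) (simp add: Cay_def)
qed

text \<open>Counts the neighbours of \<open>pt x y\<close> on the norm-one circle of the first axis;
  exchanging the arguments gives the count for the second axis.\<close>

definition circle_count :: "'a \<Rightarrow> 'a \<Rightarrow> nat" where
  "circle_count x y = card {a \<in> unit_norm. (x - a \<noteq> 0 \<or> y \<noteq> 0) \<and> (x - a) ^ (r + 1) = y ^ (r + 1)}"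

text \<open>Additivity of Frobenius makes the two signs cancel without a case split on the parity of
  \<open>r\<close>.\<close>

lemma norm_uminus: "(- a) ^ (r + 1) = (a :: 'a) ^ (r + 1)"
  using frobenius_diff[of 0 a] r_ge_2 by (simp add: power_0_left)

lemma circle_count_0_right: "circle_count x 0 = 0"
proof -
  have "{a \<in> unit_norm. (x - a \<noteq> 0 \<or> (0::'a) \<noteq> 0) \<and> (x - a) ^ (r + 1) = 0 ^ (r + 1)} = {}" by auto
  then show ?thesis by (simp only: circle_count_def) simp
qed

lemma circle_count_0_left:
  assumes "y \<in> K"
  shows "circle_count 0 y = (if y \<in> unit_norm then r + 1 else 0)"
proof -
  have "{a \<in> unit_norm. (0 - a \<noteq> 0 \<or> y \<noteq> 0) \<and> (0 - a) ^ (r + 1) = y ^ (r + 1)} =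
    (if y \<in> unit_norm then unit_norm else {})"
    using unit_normD assms norm_uminus by (auto simp: unit_norm_def)
  then show ?thesis by (simp add: circle_count_def card_unit_norm)
qed

text \<open>
  If \<open>x - a = y c\<close> with \<open>N c = 1\<close>, then \<open>y - b = x / c\<close> for \<open>b = - a / c\<close>; the map \<open>a \<mapsto> b\<close> is undone by
  the same formula with \<open>x\<close> and \<open>y\<close> exchanged.
\<close>

lemma circle_count_le:
  assumes "x \<in> K" "y \<in> K" "x \<noteq> 0" "y \<noteq> 0"
  shows "circle_count x y \<le> circle_count y x"
  unfolding circle_count_def
proof (rule card_inj_on_le)
  let ?h = "\<lambda>x y a. - (a * y) / (x - a)"
  let ?A = "\<lambda>x y. {a \<in> unit_norm. (x - a \<noteq> 0 \<or> y \<noteq> 0) \<and> (x - a) ^ (r + 1) = y ^ (r + 1)}"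
  have nz: "x - a \<noteq> 0" if "a \<in> ?A x y" for a
    using that assms(4) by auto
  have y_h: "y - ?h x y a = x * y / (x - a)" if "a \<in> ?A x y" for a
    using nz[OF that] by (simp add: field_simps)
  show "?h x y ` ?A x y \<subseteq> ?A y x"
  proof
    fix b assume "b \<in> ?h x y ` ?A x y"
    then obtain a where a: "a \<in> ?A x y" "b = ?h x y a" by blast
    then have n: "(x - a) ^ (r + 1) = y ^ (r + 1)" "a ^ (r + 1) = 1" "a \<in> K"
      using unit_normD by auto
    have y0: "y ^ (r + 1) \<noteq> 0" using assms(4) by simp
    have "b ^ (r + 1) = 1"
      unfolding a(2) power_divide norm_uminus power_mult_distrib n using y0 by simp
    moreover have "b \<in> K"
      unfolding a(2) by (intro subfield_divide[OF K] subfield_uminus[OF K] subfield_mult[OF K]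
          subfield_diff[OF K] assms n(3))
    moreover have "(y - b) ^ (r + 1) = x ^ (r + 1)"
      unfolding a(2) y_h[OF a(1)] power_divide power_mult_distrib n(1) using y0 by simp
    ultimately show "b \<in> ?A y x" using assms(3) by (simp add: unit_norm_def)
  qed
  have "?h y x (?h x y a) = a" if "a \<in> ?A x y" for a
    unfolding y_h[OF that] using nz[OF that] assms(3,4) by (simp add: field_simps)
  then show "inj_on (?h x y) (?A x y)" by (rule inj_on_inverseI)
qed simp

text \<open>Off the axes the two circle counts agree, so the neighbour sum is 0. A point of one
  circle is adjacent to all \<open>r + 1\<close> points of the other and to none of its own.\<close>

lemma tight_negative:
  "weight_distribution_bound_tight (Cay S) (- real (r + 1))"
proof -
  let ?A = "(\<lambda>a. pt a 0) ` unit_norm" and ?B = "(\<lambda>b. pt 0 b) ` unit_norm"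
  let ?f = "\<lambda>z. ind ?A z - ind ?B z"
  have 0: "0 \<in> K" by (rule subfield_0[OF K])
  have inj: "inj_on (\<lambda>a. pt a 0) unit_norm" "inj_on (\<lambda>b. pt 0 b) unit_norm"
    using pt_eq_iff 0 unit_normD by (auto intro!: inj_onI)
  have disj: "?A \<inter> ?B = {}" using pt_eq_iff 0 unit_normD by fastforce
  have support: "{z. ?f z \<noteq> 0} = ?A \<union> ?B" using disj by auto
  have "card {z. ?f z \<noteq> 0} = 2 * (r + 1)"
    unfolding support using disj by (simp add: card_Un_disjoint card_image inj card_unit_norm)
  then have "real (card {z. ?f z \<noteq> 0}) = - 2 * (- real (r + 1))" by simp
  moreover have "eigenfunction (Cay S) (- real (r + 1)) ?f"
    unfolding eigenfunction_Cay
  proof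
    show "\<exists>x. ?f x \<noteq> 0" using support one_unit_norm by blast
    show "\<forall>z. - real (r + 1) * ?f z = nsum S ?f z"
    proof
      fix z
      obtain x y where z: "x \<in> K" "y \<in> K" "z = pt x y" by (rule pt_cases)
      have "nbhd (Cay S) z \<inter> ?A = (\<lambda>a. pt a 0) `
          {a \<in> unit_norm. (x - a \<noteq> 0 \<or> y \<noteq> 0) \<and> (x - a) ^ (r + 1) = y ^ (r + 1)}"
        using z pt_S_iff subfield_diff[OF K] unit_normD
        by (auto simp: nbhd_Cay pt_diff simp del: power_Suc)
      then have cA: "card (nbhd (Cay S) z \<inter> ?A) = circle_count x y"
        unfolding circle_count_def
        by (simp only:) (rule card_image, rule inj_on_subset[OF inj(1)], blast)
      have "nbhd (Cay S) z \<inter> ?B = (\<lambda>b. pt 0 b) `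
          {b \<in> unit_norm. (y - b \<noteq> 0 \<or> x \<noteq> 0) \<and> (y - b) ^ (r + 1) = x ^ (r + 1)}"
        using z pt_S_iff subfield_diff[OF K] unit_normD
        by (auto simp: nbhd_Cay pt_diff simp del: power_Suc)
      then have cB: "card (nbhd (Cay S) z \<inter> ?B) = circle_count y x"
        unfolding circle_count_def
        by (simp only:) (rule card_image, rule inj_on_subset[OF inj(2)], blast)
      have "nsum S ?f z = real (circle_count x y) - real (circle_count y x)"
        unfolding nsum_def sum_subtractf by (simp add: sum.If_cases cA cB)
      moreover have "z \<in> ?A \<longleftrightarrow> x \<in> unit_norm \<and> y = 0" "z \<in> ?B \<longleftrightarrow> x = 0 \<and> y \<in> unit_norm"
        using z 0 pt_eq_iff unit_normD by (auto simp: image_iff)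
      moreover have "x \<noteq> 0 \<Longrightarrow> y \<noteq> 0 \<Longrightarrow> circle_count x y = circle_count y x"
        using circle_count_le z by (simp add: dual_order.antisym)
      ultimately show "- real (r + 1) * ?f z = nsum S ?f z"
        using circle_count_0_right circle_count_0_left z unit_normD[of 0]
        by (cases "x = 0"; cases "y = 0") auto
    qed
  qed
  ultimately show ?thesis
    unfolding weight_distribution_bound_tight_def weight_distribution_bound_def
    by (intro exI[of _ ?f]) (simp add: Cay_def)
qed

lemma nonprincipal_eigenvalues_Cay:
  "nonprincipal_eigenvalues (Cay S) ((r + 1) * (r ^ 2 - 1)) =
     {real (r ^ 2) - real (r + 1), - real (r + 1)}"
proof -
  have ev: "\<exists>f. eigenfunction (Cay S) (real (r ^ 2) - real (r + 1)) f"
    "\<exists>f. eigenfunction (Cay S) (- real (r + 1)) f"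
    using tight_positive(2) tight_negative by (auto simp: weight_distribution_bound_tight_def)
  \<comment> \<open>Neither value equals the valency, so excluding the principal eigenvalue removes
    neither.\<close>
  have "1 * (r ^ 2 - 1) \<le> (r + 1) * (r ^ 2 - 1)" by (rule mult_right_mono) auto
  then have "real (r ^ 2) < real ((r + 1) * (r ^ 2 - 1)) + real (r + 1)"
    unfolding of_nat_add[symmetric] of_nat_less_iff using r_ge_2 by linarith
  moreover have "0 \<le> real ((r + 1) * (r ^ 2 - 1))" "0 < real (r + 1)" by simp_all
  ultimately have neq: "real (r ^ 2) - real (r + 1) \<noteq> real ((r + 1) * (r ^ 2 - 1))"
    "- real (r + 1) \<noteq> real ((r + 1) * (r ^ 2 - 1))" by linarith+
  show ?thesis
  proof (intro equalityI subsetI)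
    fix \<theta> assume "\<theta> \<in> nonprincipal_eigenvalues (Cay S) ((r + 1) * (r ^ 2 - 1))"
    then show "\<theta> \<in> {real (r ^ 2) - real (r + 1), - real (r + 1)}"
      using eigenvalue_cases unfolding nonprincipal_eigenvalues_def by blast
  next
    fix \<theta> assume "\<theta> \<in> {real (r ^ 2) - real (r + 1), - real (r + 1)}"
    then show "\<theta> \<in> nonprincipal_eigenvalues (Cay S) ((r + 1) * (r ^ 2 - 1))"
      using ev neq unfolding nonprincipal_eigenvalues_def mem_Collect_eq insert_iff empty_iff by metis
  qed
qed

end

theorem theorem1p4:
  fixes q r :: nat and Fq Fr :: "'f::{field,finite} set"
  assumes "primepow r" and "q = r ^ 2"
    and "card (UNIV :: 'f set) = q ^ 2"
    and "is_subfield Fq" and "card Fq = q"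
    and "is_subfield Fr" and "card Fr = r"
  shows "card (Cay ` {S. extremal Fq S}) = (q + 1) * r \<and>
    (\<forall>S. peisert_type Fq 3 S \<longrightarrow> (\<exists>!T. extremal Fq T \<and> S \<subseteq> T)) \<and>
    (\<forall>S T. extremal Fq S \<and> extremal Fq T \<longrightarrow> isomorphic (Cay S) (Cay T)) \<and>
    (\<forall>S. extremal Fq S \<longrightarrow>
       isomorphic (Cay S) (VO_plus_4 Fr) \<and>
       card {C. canonical_clique Fq S C \<and> 0 \<in> C} = r + 1 \<and>
       card {C. noncanonical_clique Fq S C \<and> 0 \<in> C} = r + 1 \<and>
       (\<exists>D. {C. (canonical_clique Fq S C \<or> noncanonical_clique Fq S C) \<and> 0 \<in> C}
              \<subseteq> set_orbit (Cay S) D) \<and>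
       (\<forall>C. maximal_clique (Cay S) C \<longrightarrow> maximum_clique (Cay S) C) \<and>
       (\<exists>k l m \<theta>1 \<theta>2. primitive_strongly_regular (Cay S) k l m \<and>
          nonprincipal_eigenvalues (Cay S) k = {\<theta>1, \<theta>2} \<and> \<theta>2 < 0 \<and> 0 < \<theta>1 \<and>
          weight_distribution_bound_tight (Cay S) \<theta>1 \<and>
          weight_distribution_bound_tight (Cay S) \<theta>2))"
proof -
  interpret field_tower Fq Fr r
    by unfold_locales (use assms in \<open>simp_all add: power_mult[symmetric]\<close>)
  have VO: "isomorphic (Cay S) (VO_plus_4 Fr)" if "extremal Fq S" for S
    using that VO_plus_4_isomorphic_baer isomorphic_sym by (auto simp: extremal_iff)
  have iso: "isomorphic (Cay S) (Cay T)" if "extremal Fq S" "extremal Fq T" for S T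
    using isomorphic_trans[OF VO[OF that(1)] isomorphic_sym[OF VO[OF that(2)]]] .
  have props: "card {C. canonical_clique Fq S C \<and> 0 \<in> C} = r + 1 \<and>
       card {C. noncanonical_clique Fq S C \<and> 0 \<in> C} = r + 1 \<and>
       (\<exists>D. {C. (canonical_clique Fq S C \<or> noncanonical_clique Fq S C) \<and> 0 \<in> C}
              \<subseteq> set_orbit (Cay S) D) \<and>
       (\<forall>C. maximal_clique (Cay S) C \<longrightarrow> maximum_clique (Cay S) C) \<and>
       (\<exists>k l m \<theta>1 \<theta>2. primitive_strongly_regular (Cay S) k l m \<and>
          nonprincipal_eigenvalues (Cay S) k = {\<theta>1, \<theta>2} \<and> \<theta>2 < 0 \<and> 0 < \<theta>1 \<and>
          weight_distribution_bound_tight (Cay S) \<theta>1 \<and>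
          weight_distribution_bound_tight (Cay S) \<theta>2)"
    if S: "extremal Fq S" for S
  proof -
    obtain u v where "norm_coords Fq Fr r u v S"
      using S baer_norm_coords unfolding extremal_iff by blast
    then interpret norm_coords Fq Fr r u v S .
    have neg: "- real (r + 1) < 0" by simp
    show ?thesis
      using card_canonical_cliques_0 card_noncanonical_cliques_0 cliques_0_one_orbit
        maximal_imp_maximum primitive_strongly_regular_Cay nonprincipal_eigenvalues_Cay neg
        tight_positive tight_negative by blast
  qed
  show ?thesis
    using card_Cay_extremal type_3_unique_extremal VO iso props assms(2) by simp
qed

end
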